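(* Let $r\ge 1$, let $l_1\ge\dots\ge l_r\ge 0$ be integers, and let $\boldsymbol m=(m_1,\dots,m_r)\in\mathbb C^r$, $k\in\mathbb C$ be any parameters for which the Jacobi-Piñeiro polynomial $P_{\boldsymbol m,\boldsymbol l,k}(x)$ is defined. Then $$D_{\boldsymbol m,\boldsymbol l,k}\,P_{\boldsymbol m,\boldsymbol l,k}(x)=0 ,$$ where $D_{\boldsymbol m,\boldsymbol l,k}$ is the linear differential operator of order $r+1$ with rational coefficients in $x$ defined in the context.
   Context: Write $\boldsymbol m=(m_1,\dots,m_r)$, $\boldsymbol l=(l_1,\dots,l_r)$, with the convention $l_0=k$, $l_{r+1}=0$. Jacobi-Piñeiro polynomial. Fix integers $l_1\ge\dots\ge l_r\ge0$. $P_{\boldsymbol m,\boldsymbol l,k}(x)$ is the unique monic polynomial in $x$ of degree $l_1$, with coefficients rational functions of the parameters $(m_1,\dots,m_r,k)$, such that for all negative real $m_1,\dots,m_r,k$ for which its coefficients are defined and the integrals below converge, it is orthogonal to the $l_1$ functions $$x^{-\sum_{i=2}^{j}m_i-(j-1)+t},\qquad j=1,\dots,r,\quad t=0,1,\dots,l_j-l_{j+1}-1$$ (for $j=1$ these are $1,x,\dots,x^{l_1-l_2-1}$) with respect to the pairing $(f,g)=\int_0^1 f(x)g(x)(x-1)^{-k-1}x^{-m_1-1}\,dx$ (the choice of branch of $(x-1)^{-k-1}$ on $(0,1)$ is irrelevant). For complex $(\boldsymbol m,k)$ the polynomial $P_{\boldsymbol m,\boldsymbol l,k}(x)$ is obtained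 by evaluating these rational functions at $(\boldsymbol m,k)$; it is defined for almost all complex $(\boldsymbol m,k)$, namely whenever the rational functions are regular there. The operator. For $i=0,\dots,r$ put $$d_i=\sum_{s=r+1-i}^{r}m_s-l_{r-i+1}+l_{r-i}+i,\qquad a_i=\sum_{s=r+1-i}^{r}m_s+i,$$ $d(\alpha)=\prod_{i=0}^r(\alpha-d_i)$, $a(\alpha)=\prod_{i=0}^r(\alpha-a_i)$, and define numbers $A_i,B_i$ ($i=0,\dots,r+1$) by $$d(\alpha)=A_0+\sum_{i=1}^{r+1}A_i\,\alpha(\alpha-1)\cdots(\alpha-i+1),\qquad a(\alpha)=B_0+\sum_{i=1}^{r+1}B_i\,\alpha(\alpha-1)\cdots(\alpha-i+1).$$ Let $\tau(x)=(x-1)^k x^{\sum_{i=1}^r m_i}$ and $$D_{\boldsymbol m,\boldsymbol l,k}=\tau(x)\sum_{i=0}^{r+1}(-1)^{r+1+i}\,\frac{d^i}{dx^i}\circ\frac{A_i x-B_i}{x^{r+1-i}(x-1)}\circ\frac1{\tau(x)} ,$$ where functions denote multiplication operators and juxtaposition/$\circ$ is composition; i.e. $D_{\boldsymbol m,\boldsymbol l,k}f=\tau\sum_i(-1)^{r+1+i}\frac{d^i}{dx^i}\Big(\frac{A_ix-B_i}{x^{r+1-i}(x-1)}\frac{f}{\tau}\Big)$. Since $\tau'/\tau$ is rational, the coefficients of $D_{\boldsymbol m,\boldsymbol l,k}$ are rational functions of $x$, independent of the branch of $\tau$. *)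

theory Defs
  imports
    "HOL-Complex_Analysis.Complex_Analysis"
    "HOL-Library.Poly_Mapping"
    "HOL-Computational_Algebra.Fraction_Field"
begin

section \<open>Rational functions in several variables\<close>

text \<open>
  An element of \<open>mpoly\<close> is a polynomial over the complex numbers in variables indexed by the
  natural numbers: it maps an exponent vector to its coefficient.  Variable \<open>0\<close> plays the role
  of \<open>k\<close> and variable \<open>i \<ge> 1\<close> that of \<open>m\<^sub>i\<close>.
\<close>

type_synonym mpoly = "(nat \<Rightarrow>\<^sub>0 nat) \<Rightarrow>\<^sub>0 complex"
type_synonym ratfun = "mpoly fract"

definition mpoly_eval :: "(nat \<Rightarrow> complex) \<Rightarrow> mpoly \<Rightarrow> complex" where
  "mpoly_eval x p =
     (\<Sum>e\<in>Poly_Mapping.keys p. Poly_Mapping.lookup p e *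
        (\<Prod>i\<in>Poly_Mapping.keys e. x i ^ Poly_Mapping.lookup e i))"

definition mpoly_vars :: "mpoly \<Rightarrow> nat set" where
  "mpoly_vars p = (\<Union>e\<in>Poly_Mapping.keys p. Poly_Mapping.keys e)"

text \<open>The subfield of rational functions in the variables \<open>0, \<dots>, r\<close>.\<close>

definition ratfun_in :: "nat \<Rightarrow> ratfun \<Rightarrow> bool" where
  "ratfun_in r f \<longleftrightarrow>
     (\<exists>p q. q \<noteq> 0 \<and> mpoly_vars p \<subseteq> {0..r} \<and> mpoly_vars q \<subseteq> {0..r} \<and> f = Fract p q)"

definition rf_regular :: "ratfun \<Rightarrow> (nat \<Rightarrow> complex) \<Rightarrow> bool" where
  "rf_regular f x \<longleftrightarrow> (\<exists>p q. f = Fract p q \<and> mpoly_eval x q \<noteq> 0)"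

text \<open>
  At points where \<open>f\<close> is not regular, \<open>rf_eval\<close> is unspecified; elsewhere the value does not
  depend on the representation, see \<open>rf_eval_Fract\<close> below.
\<close>

definition rf_eval :: "(nat \<Rightarrow> complex) \<Rightarrow> ratfun \<Rightarrow> complex" where
  "rf_eval x f =
     (THE v. \<exists>p q. f = Fract p q \<and> mpoly_eval x q \<noteq> 0 \<and> v = mpoly_eval x p / mpoly_eval x q)"

lemma mpoly_eval_superset:
  assumes "finite K" "Poly_Mapping.keys p \<subseteq> K"
  shows "mpoly_eval x p = (\<Sum>e\<in>K. Poly_Mapping.lookup p e *
    (\<Prod>i\<in>Poly_Mapping.keys e. x i ^ Poly_Mapping.lookup e i))"
  unfolding mpoly_eval_def using assms
  by (intro sum.mono_neutral_left) (auto simp: in_keys_iff)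

lemma mpoly_eval_zero [simp]: "mpoly_eval x 0 = 0"
  by (simp add: mpoly_eval_def)

lemma mpoly_eval_add: "mpoly_eval x (p + q) = mpoly_eval x p + mpoly_eval x q"
proof -
  let ?K = "Poly_Mapping.keys p \<union> Poly_Mapping.keys q"
  have K: "finite ?K" "Poly_Mapping.keys (p + q) \<subseteq> ?K"
    "Poly_Mapping.keys p \<subseteq> ?K" "Poly_Mapping.keys q \<subseteq> ?K"
    using Poly_Mapping.keys_add[of p q] by auto
  show ?thesis
    unfolding mpoly_eval_superset[OF K(1,2)] mpoly_eval_superset[OF K(1,3)]
      mpoly_eval_superset[OF K(1,4)]
    by (simp add: lookup_add algebra_simps sum.distrib)
qed

lemma mpoly_eval_single:
  "mpoly_eval x (Poly_Mapping.single e c) =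
     c * (\<Prod>i\<in>Poly_Mapping.keys e. x i ^ Poly_Mapping.lookup e i)"
  by (simp add: mpoly_eval_def)

lemma monomial_eval_add:
  fixes x :: "nat \<Rightarrow> complex" and d e :: "nat \<Rightarrow>\<^sub>0 nat"
  shows "(\<Prod>i\<in>Poly_Mapping.keys (d + e). x i ^ Poly_Mapping.lookup (d + e) i) =
    (\<Prod>i\<in>Poly_Mapping.keys d. x i ^ Poly_Mapping.lookup d i) *
    (\<Prod>i\<in>Poly_Mapping.keys e. x i ^ Poly_Mapping.lookup e i)"
proof -
  let ?K = "Poly_Mapping.keys d \<union> Poly_Mapping.keys e"
  have sup: "(\<Prod>i\<in>Poly_Mapping.keys f. x i ^ Poly_Mapping.lookup f i) =
      (\<Prod>i\<in>?K. x i ^ Poly_Mapping.lookup f i)"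
    if "Poly_Mapping.keys f \<subseteq> ?K" for f
    using that by (intro prod.mono_neutral_left) (auto simp: in_keys_iff)
  have "Poly_Mapping.keys (d + e) \<subseteq> ?K" using Poly_Mapping.keys_add[of d e] by auto
  from sup[OF this] sup[of d] sup[of e] show ?thesis
    by (simp add: lookup_add power_add prod.distrib)
qed

lemma mpoly_eq_sum_single:
  fixes p :: mpoly
  shows "p = (\<Sum>e\<in>Poly_Mapping.keys p. Poly_Mapping.single e (Poly_Mapping.lookup p e))"
  by (rule poly_mapping_eqI)
     (auto simp: lookup_sum lookup_single when_def in_keys_iff sum.delta)

lemma mpoly_eval_sum: "mpoly_eval x (sum f A) = (\<Sum>a\<in>A. mpoly_eval x (f a))"
  by (induction A rule: infinite_finite_induct) (auto simp: mpoly_eval_add)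

lemma mpoly_eval_mult: "mpoly_eval x (p * q) = mpoly_eval x p * mpoly_eval x q"
proof -
  have "p * q = (\<Sum>d\<in>Poly_Mapping.keys p. \<Sum>e\<in>Poly_Mapping.keys q.
      Poly_Mapping.single d (Poly_Mapping.lookup p d) * Poly_Mapping.single e (Poly_Mapping.lookup q e))"
    by (subst mpoly_eq_sum_single[of p], subst mpoly_eq_sum_single[of q]) (rule sum_product)
  also have "mpoly_eval x \<dots> = mpoly_eval x p * mpoly_eval x q"
    by (simp add: mpoly_eval_sum mult_single mpoly_eval_single monomial_eval_add)
       (simp add: mpoly_eval_def sum_product mult_ac)
  finally show ?thesis .
qed

lemma rf_eval_Fract:
  assumes "mpoly_eval x q \<noteq> 0"
  shows "rf_eval x (Fract p q) = mpoly_eval x p / mpoly_eval x q"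
  unfolding rf_eval_def
proof (rule the_equality)
  fix v
  assume "\<exists>p' q'. Fract p q = Fract p' q' \<and> mpoly_eval x q' \<noteq> 0 \<and>
    v = mpoly_eval x p' / mpoly_eval x q'"
  then obtain p' q' where *: "Fract p q = Fract p' q'" "mpoly_eval x q' \<noteq> 0"
    "v = mpoly_eval x p' / mpoly_eval x q'" by blast
  have "q \<noteq> 0" "q' \<noteq> 0" using assms *(2) by auto
  with *(1) have "p * q' = p' * q" by (simp add: eq_fract)
  then have "mpoly_eval x p * mpoly_eval x q' = mpoly_eval x p' * mpoly_eval x q"
    by (metis mpoly_eval_mult)
  with assms *(2) show "v = mpoly_eval x p / mpoly_eval x q"
    unfolding *(3) by (simp add: frac_eq_eq)
qed (use assms in blast)


section \<open>The Jacobi-Pineiro polynomial\<close>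

text \<open>
  The family \<open>l\<close> with the conventions \<open>l\<^sub>0 = k\<close> and \<open>l\<^bsub>r+1\<^esub> = 0\<close>; only the values of \<open>l\<close> at
  \<open>1, \<dots>, r\<close> matter.
\<close>

definition l_nat :: "nat \<Rightarrow> (nat \<Rightarrow> nat) \<Rightarrow> nat \<Rightarrow> nat" where
  "l_nat r l i = (if 1 \<le> i \<and> i \<le> r then l i else 0)"

definition l_ext :: "nat \<Rightarrow> (nat \<Rightarrow> nat) \<Rightarrow> complex \<Rightarrow> nat \<Rightarrow> complex" where
  "l_ext r l k i = (if i = 0 then k else of_nat (l_nat r l i))"

text \<open>
  A polynomial in \<open>x\<close> whose coefficients are rational functions of \<open>(k, m\<^sub>1, \<dots>, m\<^sub>r)\<close>, and its
  specialization at complex parameters (note that \<open>m(0 := k)\<close> is the point with coordinates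
  \<open>k, m\<^sub>1, m\<^sub>2, \<dots>\<close>).
\<close>

definition defined_at :: "ratfun poly \<Rightarrow> (nat \<Rightarrow> complex) \<Rightarrow> complex \<Rightarrow> bool" where
  "defined_at P m k \<longleftrightarrow> (\<forall>i. rf_regular (coeff P i) (m(0 := k)))"

definition specialize :: "ratfun poly \<Rightarrow> (nat \<Rightarrow> complex) \<Rightarrow> complex \<Rightarrow> complex poly" where
  "specialize P m k = map_poly (rf_eval (m(0 := k))) P"

definition jp_fun :: "(nat \<Rightarrow> real) \<Rightarrow> nat \<Rightarrow> nat \<Rightarrow> real \<Rightarrow> real" where
  "jp_fun m j t x = x powr (- (\<Sum>i=2..j. m i) - (real j - 1) + real t)"

text \<open>The integrand of the pairing, with the principal branch of \<open>(x - 1) powr (- k - 1)\<close>.\<close>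

definition jp_integrand ::
  "(nat \<Rightarrow> real) \<Rightarrow> real \<Rightarrow> (real \<Rightarrow> complex) \<Rightarrow> (real \<Rightarrow> real) \<Rightarrow> real \<Rightarrow> complex" where
  "jp_integrand m k f g x =
     f x * of_real (g x) * of_real (x - 1) powr of_real (- k - 1) * of_real (x powr (- m 1 - 1))"

definition jp_pairing ::
  "(nat \<Rightarrow> real) \<Rightarrow> real \<Rightarrow> (real \<Rightarrow> complex) \<Rightarrow> (real \<Rightarrow> real) \<Rightarrow> complex" where
  "jp_pairing m k f g = integral {0<..<1} (jp_integrand m k f g)"

definition jp_index :: "nat \<Rightarrow> (nat \<Rightarrow> nat) \<Rightarrow> (nat \<times> nat) set" where
  "jp_index r l = {(j, t). 1 \<le> j \<and> j \<le> r \<and> t < l_nat r l j - l_nat r l (j + 1)}"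

text \<open>
  The convergence condition asks that the pairing of each of the given functions with every
  polynomial of degree at most \<open>l\<^sub>1\<close> converges, and not merely its pairing with the specialized
  polynomial \<open>P\<close>.  The latter would be too liberal: for \<open>r = 2\<close> and \<open>l = (1, 1)\<close> the orthogonality
  relation yields \<open>P = x - c / (c - k)\<close> where \<open>c = - m\<^sub>1 - m\<^sub>2 - 1\<close>.  If \<open>c = 0\<close> then \<open>P = x\<close>, and
  the pairing with \<open>P\<close> is the integral of \<open>(x - 1) powr (- k - 1)\<close>, which converges to a nonzero
  number although the pairing itself diverges on constants.
\<close>

definition jp_converges :: "nat \<Rightarrow> (nat \<Rightarrow> nat) \<Rightarrow> (nat \<Rightarrow> real) \<Rightarrow> real \<Rightarrow> bool" where
  "jp_converges r l m k \<longleftrightarrow>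
     (\<forall>(j, t) \<in> jp_index r l. \<forall>f :: complex poly. degree f \<le> l 1 \<longrightarrow>
        jp_integrand m k (\<lambda>x. poly f (of_real x)) (jp_fun m j t) integrable_on {0<..<1})"

definition is_jacobi_pineiro :: "nat \<Rightarrow> (nat \<Rightarrow> nat) \<Rightarrow> ratfun poly \<Rightarrow> bool" where
  "is_jacobi_pineiro r l P \<longleftrightarrow>
     degree P = l 1 \<and> lead_coeff P = 1 \<and> (\<forall>i. ratfun_in r (coeff P i)) \<and>
     (\<forall>(m :: nat \<Rightarrow> real) (k :: real).
        (\<forall>i\<in>{1..r}. m i < 0) \<longrightarrow> k < 0 \<longrightarrow>
        defined_at P (\<lambda>i. of_real (m i)) (of_real k) \<longrightarrow> jp_converges r l m k \<longrightarrow>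
        (\<forall>(j, t) \<in> jp_index r l.
           jp_pairing m k
             (\<lambda>x. poly (specialize P (\<lambda>i. of_real (m i)) (of_real k)) (of_real x))
             (jp_fun m j t) = 0))"


section \<open>The differential operator\<close>

definition falling :: "nat \<Rightarrow> complex \<Rightarrow> complex" where
  "falling i a = (\<Prod>j<i. a - of_nat j)"

definition falling_coeffs :: "nat \<Rightarrow> (complex \<Rightarrow> complex) \<Rightarrow> nat \<Rightarrow> complex" where
  "falling_coeffs n f =
     (THE c. (\<forall>a. f a = (\<Sum>i=0..n. c i * falling i a)) \<and> (\<forall>i>n. c i = 0))"

lemma falling_Suc: "falling (Suc i) a = (a - of_nat i) * falling i a"
  by (simp add: falling_def mult.commute)

lemma falling_expansion_exists:
  "\<exists>c. (\<forall>a. (\<Prod>i<n. a - d i) = (\<Sum>i=0..n. c i * falling i a)) \<and> (\<forall>i>n. c i = 0)"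
proof (induction n)
  case 0
  show ?case by (rule exI[of _ "\<lambda>i. if i = 0 then 1 else 0"]) (simp add: falling_def)
next
  case (Suc n)
  then obtain c where c: "\<And>a. (\<Prod>i<n. a - d i) = (\<Sum>i=0..n. c i * falling i a)"
    and c0: "\<And>i. i > n \<Longrightarrow> c i = 0" by blast
  define c' where "c' i = (of_nat i - d n) * c i + (if i = 0 then 0 else c (i - 1))" for i
  have "(\<Prod>i<Suc n. a - d i) = (\<Sum>i=0..Suc n. c' i * falling i a)" for a
  proof -
    have "(\<Prod>i<Suc n. a - d i) = (\<Sum>i=0..n. (a - d n) * (c i * falling i a))"
      by (simp add: c sum_distrib_left mult.commute)
    also have "\<dots> = (\<Sum>i=0..n. (of_nat i - d n) * c i * falling i a + c i * falling (Suc i) a)"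
      by (intro sum.cong) (simp_all add: falling_Suc algebra_simps)
    also have "\<dots> = (\<Sum>i=0..Suc n. (of_nat i - d n) * c i * falling i a) +
        (\<Sum>i=0..n. c i * falling (Suc i) a)"
      by (simp add: sum.distrib c0)
    also have "(\<Sum>i=0..n. c i * falling (Suc i) a) =
        (\<Sum>i=0..Suc n. (if i = 0 then 0 else c (i - 1)) * falling i a)"
      by (subst sum.atLeast0_atMost_Suc_shift) simp
    finally show ?thesis by (simp only: c'_def distrib_right sum.distrib)
  qed
  moreover have "\<forall>i>Suc n. c' i = 0" by (simp add: c'_def c0)
  ultimately show ?case by blast
qed

lemma falling_expansion_zero:
  assumes "\<And>a. (\<Sum>i=0..n. c i * falling i a) = 0" and "i \<le> n"
  shows "c i = 0"
  using assms(2)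
proof (induction i rule: less_induct)
  case (less i)
  have "falling j (of_nat i) = 0" if "j > i" for j
    using that by (auto simp: falling_def)
  then have "c j * falling j (of_nat i) = 0" if "j \<noteq> i" "j \<le> n" for j
    using less that by (cases "j < i") auto
  then have "(\<Sum>j=0..n. c j * falling j (of_nat i)) = (\<Sum>j\<in>{i}. c j * falling j (of_nat i))"
    using less.prems by (intro sum.mono_neutral_right) auto
  moreover have "falling i (of_nat i) \<noteq> 0" by (auto simp: falling_def)
  ultimately show ?case using assms(1)[of "of_nat i"] by simp
qed

lemma falling_coeffs_unique:
  assumes "\<And>a. f a = (\<Sum>i=0..n. c i * falling i a)" "\<And>i. i > n \<Longrightarrow> c i = 0"
  shows "falling_coeffs n f = c"
  unfolding falling_coeffs_def
proof (rule the_equality)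
  fix b assume b: "(\<forall>a. f a = (\<Sum>i=0..n. b i * falling i a)) \<and> (\<forall>i>n. b i = 0)"
  then have "(\<Sum>i=0..n. (b i - c i) * falling i a) = 0" for a
    using assms(1)[of a] by (simp add: left_diff_distrib sum_subtractf)
  then have "b i - c i = 0" if "i \<le> n" for i
    using falling_expansion_zero[where n = n and c = "\<lambda>i. b i - c i"] that by blast
  then show "b = c" using b assms(2) by (intro ext) (metis eq_iff_diff_eq_0 not_le)
qed (use assms in blast)

lemma falling_coeffs_prod:
  "(\<Prod>i=0..r. a - d i) =
     (\<Sum>i=0..Suc r. falling_coeffs (Suc r) (\<lambda>a. \<Prod>i=0..r. a - d i) i * falling i a)"
proof -
  have *: "(\<Prod>i=0..r. a - d i) = (\<Prod>i<Suc r. a - d i)" for a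
    by (simp add: atLeast0AtMost lessThan_Suc_atMost)
  obtain c where c: "\<And>a. (\<Prod>i=0..r. a - d i) = (\<Sum>i=0..Suc r. c i * falling i a)"
    "\<And>i. i > Suc r \<Longrightarrow> c i = 0"
    using falling_expansion_exists[where n = "Suc r" and d = d] unfolding * by blast
  have "falling_coeffs (Suc r) (\<lambda>a. \<Prod>i=0..r. a - d i) = c"
    by (rule falling_coeffs_unique) (use c in blast)+
  then show ?thesis using c(1) by simp
qed

definition jp_d ::
  "nat \<Rightarrow> (nat \<Rightarrow> nat) \<Rightarrow> (nat \<Rightarrow> complex) \<Rightarrow> complex \<Rightarrow> nat \<Rightarrow> complex" where
  "jp_d r l m k i =
     (\<Sum>s=r+1-i..r. m s) - l_ext r l k (r + 1 - i) + l_ext r l k (r - i) + of_nat i"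

definition jp_a :: "nat \<Rightarrow> (nat \<Rightarrow> complex) \<Rightarrow> nat \<Rightarrow> complex" where
  "jp_a r m i = (\<Sum>s=r+1-i..r. m s) + of_nat i"

definition jp_A ::
  "nat \<Rightarrow> (nat \<Rightarrow> nat) \<Rightarrow> (nat \<Rightarrow> complex) \<Rightarrow> complex \<Rightarrow> nat \<Rightarrow> complex" where
  "jp_A r l m k = falling_coeffs (r + 1) (\<lambda>a. \<Prod>i=0..r. a - jp_d r l m k i)"

definition jp_B :: "nat \<Rightarrow> (nat \<Rightarrow> complex) \<Rightarrow> nat \<Rightarrow> complex" where
  "jp_B r m = falling_coeffs (r + 1) (\<lambda>a. \<Prod>i=0..r. a - jp_a r m i)"

text \<open>
  \<open>\<tau>\<close> is a holomorphic branch on \<open>U\<close> of the multivalued function \<open>(x - 1)\<^sup>k x\<^sup>s\<close>, where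
  \<open>s = m\<^sub>1 + \<dots> + m\<^sub>r\<close>; in particular \<open>0\<close> and \<open>1\<close> are not in \<open>U\<close>.
\<close>

definition tau_branch ::
  "nat \<Rightarrow> (nat \<Rightarrow> complex) \<Rightarrow> complex \<Rightarrow> complex set \<Rightarrow> (complex \<Rightarrow> complex) \<Rightarrow> bool" where
  "tau_branch r m k U \<tau> \<longleftrightarrow>
     (\<exists>L0 L1. L0 holomorphic_on U \<and> L1 holomorphic_on U \<and>
        (\<forall>x\<in>U. exp (L0 x) = x \<and> exp (L1 x) = x - 1 \<and>
           \<tau> x = exp (k * L1 x) * exp ((\<Sum>i=1..r. m i) * L0 x)))"

definition jp_operator ::
  "nat \<Rightarrow> (nat \<Rightarrow> nat) \<Rightarrow> (nat \<Rightarrow> complex) \<Rightarrow> complex \<Rightarrow> (complex \<Rightarrow> complex) \<Rightarrow>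
     (complex \<Rightarrow> complex) \<Rightarrow> complex \<Rightarrow> complex" where
  "jp_operator r l m k \<tau> f x =
     \<tau> x * (\<Sum>i=0..r+1. (-1) ^ (r + 1 + i) *
       (deriv ^^ i) (\<lambda>z. (jp_A r l m k i * z - jp_B r m i) / (z ^ (r + 1 - i) * (z - 1))
                          * (f z / \<tau> z)) x)"

end

theory Submission
  imports Defs
begin

text \<open>
  Put \<open>M = m\<^sub>1 + \<dots> + m\<^sub>r\<close> and consider the weighted polynomial
  \<open>H = x ^ (- M - r - 1) (x - 1) ^ (- k - 1) P(x)\<close>.  Up to the factor \<open>\<tau>\<close> and a sign, the operator
  applied to \<open>P\<close> is \<open>d(-\<theta>-1) (x H) - a(-\<theta>-1) H\<close> with \<open>\<theta> = x d/dx\<close>, because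
  \<open>(-1)\<^sup>i d\<^sup>i \<circ> x\<^sup>i\<close> is the \<open>i\<close>-th falling factorial of \<open>-\<theta>-1\<close>.  Expanding at \<open>0\<close>, the equation
  says that the coefficients \<open>h\<^sub>n\<close> of \<open>P(x) (1 - x) ^ (- k - 1)\<close> satisfy
  \<open>d(a\<^sub>r - n) h\<^bsub>n-1\<^esub> = a(a\<^sub>r - n) h\<^sub>n\<close>, where \<open>a\<^sub>r = M + r\<close>.

  The recurrence comes from the Mellin transform.  The orthogonality relations are \<open>l\<^sub>1\<close> zeros of the
  Mellin transform \<open>\<phi>(s) = \<integral> x ^ s H dx\<close> on \<open>(0, 1)\<close>.  By the Beta integral that
  transform is a quotient of Gamma functions times a polynomial of degree at most \<open>l\<^sub>1\<close>
  (\<open>mellin_numerator\<close>), so the zeros determine it up to a constant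
  (\<open>mellin_numerator_factorization\<close>).  They lie in blocks of consecutive points
  from \<open>a\<^sub>i + 1\<close> to \<open>d\<^sub>i\<close> for \<open>i < r\<close>, while the Gamma quotient accounts for \<open>a\<^sub>r\<close> and \<open>d\<^sub>r\<close>;
  therefore \<open>d(s) \<phi>(s + 1) = a(s) \<phi>(s)\<close>.  The numbers \<open>h\<^sub>n\<close> are essentially its residues
  (\<open>series_coeff_via_mellin_numerator\<close>), which gives the recurrence in \<open>series_recurrence\<close>.

  This argument needs parameters at which the integrals converge and the zeros are distinct, which
  holds when all parameters are sufficiently negative reals.  Such points are Zariski dense, and the
  recurrence for each \<open>n\<close> is an algebraic identity, so it holds wherever \<open>P\<close> is defined
  (\<open>linear_relation_extends_to_regular_points\<close>, \<open>jacobi_pineiro_recurrence\<close>).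

  Finally, the operator applied to \<open>P\<close> is a fixed weight times a polynomial over a power of
  \<open>1 - x\<close>.  The recurrence forces that polynomial to vanish as a formal power series at \<open>0\<close>, hence
  identically, and so the equation holds at every point of \<open>U\<close>
  (\<open>weighted_polynomial_operator_eq_0\<close>).
\<close>

section \<open>Polynomial relations that hold generically\<close>

lemma mpoly_eval_const: "mpoly_eval y (Poly_Mapping.single 0 c) = c"
  by (simp add: mpoly_eval_single)

lemma mpoly_eval_one [simp]: "mpoly_eval y 1 = 1"
  using mpoly_eval_const[of y 1] by simp

text \<open>
  Polynomial expressions in the parameters are only ever needed through their values, so they are
  handled as functions; this replaces explicit \<open>mpoly\<close> terms by closure rules.
\<close>

definition polynomial_function :: "((nat \<Rightarrow> complex) \<Rightarrow> complex) \<Rightarrow> bool" where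
  "polynomial_function g \<longleftrightarrow> (\<exists>p. \<forall>y. mpoly_eval y p = g y)"

lemma polynomial_function_const [intro]: "polynomial_function (\<lambda>y. c)"
  unfolding polynomial_function_def using mpoly_eval_const by blast

lemma polynomial_function_var [intro]: "polynomial_function (\<lambda>y. y i)"
  unfolding polynomial_function_def
  by (rule exI[of _ "Poly_Mapping.single (Poly_Mapping.single i 1) 1"]) (simp add: mpoly_eval_single)

lemma polynomial_function_add [intro]:
  "polynomial_function f \<Longrightarrow> polynomial_function g \<Longrightarrow> polynomial_function (\<lambda>y. f y + g y)"
  unfolding polynomial_function_def by (metis mpoly_eval_add)

lemma polynomial_function_mult [intro]:
  "polynomial_function f \<Longrightarrow> polynomial_function g \<Longrightarrow> polynomial_function (\<lambda>y. f y * g y)"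
  unfolding polynomial_function_def by (metis mpoly_eval_mult)

lemma polynomial_function_diff [intro]:
  "polynomial_function f \<Longrightarrow> polynomial_function g \<Longrightarrow> polynomial_function (\<lambda>y. f y - g y)"
  using polynomial_function_add[of f "\<lambda>y. (-1) * g y"] polynomial_function_mult[of "\<lambda>y. -1" g]
  by auto

lemma polynomial_function_sum [intro]:
  "(\<And>i. i \<in> A \<Longrightarrow> polynomial_function (f i)) \<Longrightarrow> polynomial_function (\<lambda>y. \<Sum>i\<in>A. f i y)"
  by (induction A rule: infinite_finite_induct) auto

lemma polynomial_function_prod [intro]:
  "(\<And>i. i \<in> A \<Longrightarrow> polynomial_function (f i)) \<Longrightarrow> polynomial_function (\<lambda>y. \<Prod>i\<in>A. f i y)"
  by (induction A rule: infinite_finite_induct) auto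

lemma rf_regularE:
  assumes "rf_regular f y"
  obtains p q where "f = Fract p q" "mpoly_eval y q \<noteq> 0" "q \<noteq> 0"
    "rf_eval y f = mpoly_eval y p / mpoly_eval y q"
proof -
  obtain p q where "f = Fract p q" "mpoly_eval y q \<noteq> 0"
    using assms by (auto simp: rf_regular_def)
  moreover have "q \<noteq> 0" using \<open>mpoly_eval y q \<noteq> 0\<close> by auto
  ultimately show thesis using that rf_eval_Fract by blast
qed

lemma rf_mpoly:
  shows "rf_regular (Fract p 1) y" "rf_eval y (Fract p 1) = mpoly_eval y p"
proof -
  show "rf_regular (Fract p 1) y" unfolding rf_regular_def by (intro exI[of _ p] exI[of _ 1]) simp
  show "rf_eval y (Fract p 1) = mpoly_eval y p" using rf_eval_Fract[of y 1 p] by simp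
qed

lemma rf_zero: "rf_regular 0 y" "rf_eval y 0 = 0"
  using rf_mpoly[where p = 0 and y = y] by (simp_all add: Zero_fract_def)

lemma rf_add:
  assumes "rf_regular f y" "rf_regular g y"
  shows "rf_regular (f + g) y" "rf_eval y (f + g) = rf_eval y f + rf_eval y g"
proof -
  obtain p q where f: "f = Fract p q" "mpoly_eval y q \<noteq> 0" "q \<noteq> 0"
    "rf_eval y f = mpoly_eval y p / mpoly_eval y q" using assms(1) by (rule rf_regularE)
  obtain p' q' where g: "g = Fract p' q'" "mpoly_eval y q' \<noteq> 0" "q' \<noteq> 0"
    "rf_eval y g = mpoly_eval y p' / mpoly_eval y q'" using assms(2) by (rule rf_regularE)
  have eq: "f + g = Fract (p * q' + p' * q) (q * q')" using f g by simp
  have nz: "mpoly_eval y (q * q') \<noteq> 0" using f g by (simp add: mpoly_eval_mult)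
  show "rf_regular (f + g) y" using eq nz by (auto simp: rf_regular_def)
  show "rf_eval y (f + g) = rf_eval y f + rf_eval y g"
    using f(2,4) g(2,4) unfolding eq rf_eval_Fract[OF nz]
    by (simp add: mpoly_eval_mult mpoly_eval_add add_frac_eq)
qed

lemma rf_mult:
  assumes "rf_regular f y" "rf_regular g y"
  shows "rf_regular (f * g) y" "rf_eval y (f * g) = rf_eval y f * rf_eval y g"
proof -
  obtain p q where f: "f = Fract p q" "mpoly_eval y q \<noteq> 0" "q \<noteq> 0"
    "rf_eval y f = mpoly_eval y p / mpoly_eval y q" using assms(1) by (rule rf_regularE)
  obtain p' q' where g: "g = Fract p' q'" "mpoly_eval y q' \<noteq> 0" "q' \<noteq> 0"
    "rf_eval y g = mpoly_eval y p' / mpoly_eval y q'" using assms(2) by (rule rf_regularE)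
  have eq: "f * g = Fract (p * p') (q * q')" using f g by simp
  have nz: "mpoly_eval y (q * q') \<noteq> 0" using f g by (simp add: mpoly_eval_mult)
  show "rf_regular (f * g) y" using eq nz by (auto simp: rf_regular_def)
  show "rf_eval y (f * g) = rf_eval y f * rf_eval y g"
    using f(4) g(4) unfolding eq rf_eval_Fract[OF nz] by (simp add: mpoly_eval_mult)
qed

lemma rf_sum:
  assumes "\<And>i. i \<in> A \<Longrightarrow> rf_regular (f i) y"
  shows "rf_regular (\<Sum>i\<in>A. f i) y \<and> rf_eval y (\<Sum>i\<in>A. f i) = (\<Sum>i\<in>A. rf_eval y (f i))"
  using assms by (induction A rule: infinite_finite_induct) (auto simp: rf_zero rf_add)

text \<open>
  The first digit is the remainder modulo \<open>D\<close> and the other digits expand the quotient, which is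
  the induction on the number of digits.
\<close>

lemma digit_expansion_inj:
  fixes D :: nat
  assumes "\<And>i. i < n \<Longrightarrow> e i < D" "\<And>i. i < n \<Longrightarrow> e' i < D"
    and "(\<Sum>i<n. e i * D ^ i) = (\<Sum>i<n. e' i * D ^ i)" and "i < n"
  shows "e i = e' i"
  using assms
proof (induction n arbitrary: e e' i)
  case (Suc n)
  have D: "D > 0" using Suc.prems(1)[of 0] by simp
  have split: "(\<Sum>i<Suc n. f i * D ^ i) = f 0 + D * (\<Sum>i<n. f (Suc i) * D ^ i)" for f :: "nat \<Rightarrow> nat"
    unfolding sum.lessThan_Suc_shift by (simp add: sum_distrib_left mult_ac)
  have eq: "e 0 + D * (\<Sum>i<n. e (Suc i) * D ^ i) = e' 0 + D * (\<Sum>i<n. e' (Suc i) * D ^ i)"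
    using Suc.prems(3) unfolding split .
  have lt: "e 0 < D" "e' 0 < D" using Suc.prems(1,2)[of 0] by auto
  have "e 0 = e' 0" using arg_cong[OF eq, of "\<lambda>n. n mod D"] lt by simp
  moreover have "(\<Sum>i<n. e (Suc i) * D ^ i) = (\<Sum>i<n. e' (Suc i) * D ^ i)"
    using arg_cong[OF eq, of "\<lambda>n. n div D"] lt by simp
  then have "e (Suc j) = e' (Suc j)" if "j < n" for j
    using Suc.IH[of "\<lambda>i. e (Suc i)" "\<lambda>i. e' (Suc i)" j] Suc.prems(1,2) that by auto
  ultimately show ?case using Suc.prems(4) by (cases i) auto
qed simp

text \<open>
  Kronecker substitution: along the curve \<open>y\<^sub>i = - T ^ (D ^ i)\<close> a monomial becomes a power of
  \<open>T\<close> whose exponent has the exponents of the monomial as its base-\<open>D\<close> digits.  If \<open>D\<close> exceeds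
  all of them, different monomials give different powers, so nothing cancels and a nonzero
  polynomial in one variable \<open>T\<close> remains.  It has finitely many roots, hence does not vanish at
  some large \<open>T\<close>; the curve runs to minus infinity in all coordinates, which is where the integrals
  of the Jacobi-Pineiro polynomial converge.
\<close>

lemma nonzero_mpoly_nonvanishing_near_minus_infinity:
  fixes p :: mpoly and K :: real
  assumes "p \<noteq> 0"
  obtains y :: "nat \<Rightarrow> real" where "\<And>i. y i \<le> - K" "mpoly_eval (\<lambda>i. of_real (y i)) p \<noteq> 0"
proof -
  let ?E = "Poly_Mapping.keys p"
  define n where "n = Suc (Max (insert 0 (mpoly_vars p)))"
  define D where "D = Suc (Max (insert 0 (\<Union>e\<in>?E. Poly_Mapping.lookup e ` Poly_Mapping.keys e)))"
  have fin: "finite (mpoly_vars p)" by (simp add: mpoly_vars_def)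
  have supp: "Poly_Mapping.keys e \<subseteq> {..<n}" if "e \<in> ?E" for e
  proof
    fix i assume "i \<in> Poly_Mapping.keys e"
    then have "i \<in> insert 0 (mpoly_vars p)" using that by (auto simp: mpoly_vars_def)
    then show "i \<in> {..<n}" using Max_ge[of "insert 0 (mpoly_vars p)" i] fin by (simp add: n_def less_Suc_eq_le)
  qed
  have digit: "Poly_Mapping.lookup e i < D" if "e \<in> ?E" for e i
  proof (cases "i \<in> Poly_Mapping.keys e")
    case True
    then have "Poly_Mapping.lookup e i \<in> insert 0 (\<Union>e\<in>?E. Poly_Mapping.lookup e ` Poly_Mapping.keys e)"
      using that by blast
    then show ?thesis unfolding D_def less_Suc_eq_le by (intro Max_ge) auto
  qed (simp add: D_def in_keys_iff)
  define w where "w e = (\<Sum>i<n. Poly_Mapping.lookup e i * D ^ i)" for e :: "nat \<Rightarrow>\<^sub>0 nat"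
  have inj: "e = e'" if "e \<in> ?E" "e' \<in> ?E" "w e = w e'" for e e'
  proof (rule poly_mapping_eqI)
    fix i
    show "Poly_Mapping.lookup e i = Poly_Mapping.lookup e' i"
    proof (cases "i < n")
      case True
      show ?thesis
        by (rule digit_expansion_inj[of n _ D]) (use digit that True in \<open>auto simp: w_def\<close>)
    next
      case False
      then have "i \<notin> Poly_Mapping.keys e" "i \<notin> Poly_Mapping.keys e'" using supp that by fastforce+
      then show ?thesis by (simp add: in_keys_iff)
    qed
  qed
  define s where "s e = Poly_Mapping.lookup p e * (\<Prod>i\<in>Poly_Mapping.keys e. (-1) ^ Poly_Mapping.lookup e i)"
    for e
  define Q where "Q = (\<Sum>e\<in>?E. monom (s e) (w e))"
  have eval: "mpoly_eval (\<lambda>i. - (T ^ (D ^ i))) p = poly Q T" for T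
  proof -
    have "(\<Prod>i\<in>Poly_Mapping.keys e. (- (T ^ (D ^ i))) ^ Poly_Mapping.lookup e i) =
        (\<Prod>i\<in>Poly_Mapping.keys e. (-1) ^ Poly_Mapping.lookup e i) * T ^ w e" if "e \<in> ?E" for e
    proof -
      have "(\<Prod>i\<in>Poly_Mapping.keys e. (- (T ^ (D ^ i))) ^ Poly_Mapping.lookup e i) =
          (\<Prod>i\<in>Poly_Mapping.keys e. (-1) ^ Poly_Mapping.lookup e i * T ^ (Poly_Mapping.lookup e i * D ^ i))"
        by (intro prod.cong refl)
          (subst power_minus, simp add: mult.commute flip: power_mult)
      also have "\<dots> = (\<Prod>i\<in>Poly_Mapping.keys e. (-1) ^ Poly_Mapping.lookup e i) *
          T ^ (\<Sum>i\<in>Poly_Mapping.keys e. Poly_Mapping.lookup e i * D ^ i)"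
        by (simp add: prod.distrib power_sum)
      also have "(\<Sum>i\<in>Poly_Mapping.keys e. Poly_Mapping.lookup e i * D ^ i) = w e"
        unfolding w_def using supp[OF that] by (intro sum.mono_neutral_left) (auto simp: in_keys_iff)
      finally show ?thesis .
    qed
    then show ?thesis by (simp add: mpoly_eval_def Q_def poly_sum poly_monom s_def mult.assoc)
  qed
  have "Q \<noteq> 0"
  proof -
    obtain e where e: "e \<in> ?E" using assms by fastforce
    have "coeff Q (w e) = (\<Sum>e'\<in>?E. if e' = e then s e else 0)"
      unfolding Q_def coeff_sum by (intro sum.cong) (use inj e in auto)
    also have "\<dots> = s e" using e by simp
    also have "\<dots> \<noteq> 0" using e by (simp add: s_def in_keys_iff)
    finally show ?thesis by auto
  qed
  then have "finite {T. poly Q T = 0}" by (rule poly_roots_finite)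
  then have "finite (complex_of_real -` {T. poly Q T = 0})"
    by (rule finite_vimageI) (simp add: inj_def)
  then have "infinite ({max 1 K..} - complex_of_real -` {T. poly Q T = 0})"
    using infinite_Ici[of "max 1 K"] by (simp add: Diff_infinite_finite)
  then have "{max 1 K..} - complex_of_real -` {T. poly Q T = 0} \<noteq> {}"
    by (rule infinite_imp_nonempty)
  then obtain T where "T \<in> {max 1 K..} - complex_of_real -` {T. poly Q T = 0}" by blast
  then have T: "T \<ge> 1" "T \<ge> K" "poly Q (of_real T) \<noteq> 0" by simp_all
  show thesis
  proof (rule that[of "\<lambda>i. - (T ^ (D ^ i))"])
    fix i
    have "D ^ i \<ge> 1" by (simp add: D_def)
    then have "T \<le> T ^ (D ^ i)" using T(1) power_increasing[of 1 "D ^ i" T] by simp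
    then show "- (T ^ (D ^ i)) \<le> - K" using T(2) by simp
  next
    show "mpoly_eval (\<lambda>i. of_real (- (T ^ (D ^ i)))) p \<noteq> 0" using eval[of "of_real T"] T(3) by simp
  qed
qed

text \<open>
  The left-hand side is the value of a rational function \<open>E\<close>.  Were \<open>E\<close> nonzero, there would be a
  point near minus infinity at which the numerator of \<open>E\<close>, its denominator and the denominators of
  all coefficients of \<open>P\<close> are simultaneously nonzero; there \<open>E\<close> has a nonzero value and yet vanishes
  by assumption.  This carries the relation, known only for the parameters for which the integrals make
  sense, to every point at which \<open>P\<close> is defined.
\<close>

lemma linear_relation_extends_to_regular_points:
  fixes P :: "ratfun poly" and c :: "nat \<Rightarrow> (nat \<Rightarrow> complex) \<Rightarrow> complex" and K :: real
  assumes poly: "\<And>j. polynomial_function (c j)"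
    and gen: "\<And>y :: nat \<Rightarrow> real. (\<And>i. y i \<le> - K) \<Longrightarrow> (\<And>j. rf_regular (coeff P j) (\<lambda>i. of_real (y i))) \<Longrightarrow>
       (\<Sum>j\<in>A. rf_eval (\<lambda>i. of_real (y i)) (coeff P j) * c j (\<lambda>i. of_real (y i))) = 0"
    and reg: "\<And>j. rf_regular (coeff P j) z"
  shows "(\<Sum>j\<in>A. rf_eval z (coeff P j) * c j z) = 0"
proof -
  obtain C where C: "\<And>j y. mpoly_eval y (C j) = c j y"
    using poly unfolding polynomial_function_def by metis
  define E where "E = (\<Sum>j\<in>A. coeff P j * Fract (C j) 1)"
  have E: "rf_regular E y \<and> rf_eval y E = (\<Sum>j\<in>A. rf_eval y (coeff P j) * c j y)"
    if "\<And>j. rf_regular (coeff P j) y" for y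
    unfolding E_def
    using rf_sum[of A "\<lambda>j. coeff P j * Fract (C j) 1" y] rf_mult[OF that rf_mpoly(1)]
    by (simp add: rf_mpoly C)
  have "E = 0"
  proof (rule ccontr)
    assume "E \<noteq> 0"
    obtain G H where GH: "E = Fract G H" "H \<noteq> 0" by (metis Fract_cases)
    have "\<forall>j. \<exists>a b. coeff P j = Fract a b \<and> b \<noteq> 0" by (metis Fract_cases)
    then obtain N Q where NQ: "\<And>j. coeff P j = Fract (N j) (Q j)" "\<And>j. Q j \<noteq> 0" by metis
    have "G \<noteq> 0" using \<open>E \<noteq> 0\<close> GH by (auto simp: Zero_fract_def eq_fract)
    then have "G * (H * (\<Prod>j\<le>degree P. Q j)) \<noteq> 0" using GH NQ by simp
    then obtain y :: "nat \<Rightarrow> real" where y: "\<And>i. y i \<le> - K"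
      "mpoly_eval (\<lambda>i. of_real (y i)) (G * (H * (\<Prod>j\<le>degree P. Q j))) \<noteq> 0"
      by (rule nonzero_mpoly_nonvanishing_near_minus_infinity[where K = K]) blast
    let ?y = "\<lambda>i. complex_of_real (y i)"
    have nz: "mpoly_eval ?y G \<noteq> 0" "mpoly_eval ?y H \<noteq> 0" "mpoly_eval ?y (\<Prod>j\<le>degree P. Q j) \<noteq> 0"
      using y(2) by (auto simp: mpoly_eval_mult)
    have "mpoly_eval ?y (Q j) \<noteq> 0" if "j \<le> degree P" for j
      using nz(3) that prod.remove[of "{..degree P}" j Q] by (auto simp: mpoly_eval_mult)
    then have reg': "rf_regular (coeff P j) ?y" for j
      using NQ(1)[of j] by (cases "j \<le> degree P") (auto simp: rf_regular_def[of "Fract _ _"] coeff_eq_0 rf_zero)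
    have "rf_eval ?y E = 0" using E[OF reg'] gen[OF y(1) reg'] by simp
    moreover have "rf_eval ?y E = mpoly_eval ?y G / mpoly_eval ?y H"
      unfolding GH(1) by (rule rf_eval_Fract) (rule nz)
    ultimately show False using nz by simp
  qed
  then show ?thesis using E[OF reg] rf_zero(2)[of z] by simp
qed

section \<open>Derivatives of polynomials times powers\<close>

text \<open>
  The binomial series of \<open>(1 - x) ^ b\<close>, normalized to constant term \<open>1\<close>, with a complex exponent.
\<close>

definition one_minus_powr_fps :: "complex \<Rightarrow> complex fps" where
  "one_minus_powr_fps b = Abs_fps (\<lambda>n. pochhammer (- b) n / fact n)"

lemma one_minus_powr_fps_step:
  "one_minus_powr_fps b = (1 - fps_X) * one_minus_powr_fps (b - 1)"
proof (rule fps_ext)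
  fix n
  show "fps_nth (one_minus_powr_fps b) n = fps_nth ((1 - fps_X) * one_minus_powr_fps (b - 1)) n"
  proof (cases n)
    case (Suc k)
    have "pochhammer (- b) (Suc k) = pochhammer (1 - b) (Suc k) - of_nat (Suc k) * pochhammer (1 - b) k"
      unfolding pochhammer_rec[of "- b"] pochhammer_Suc[of "1 - b"] by (simp add: algebra_simps)
    then have "pochhammer (- b) (Suc k) / fact (Suc k) =
        pochhammer (1 - b) (Suc k) / fact (Suc k) - pochhammer (1 - b) k / fact k"
      by (simp add: diff_divide_distrib del: of_nat_Suc)
    then show ?thesis
      unfolding Suc by (simp add: one_minus_powr_fps_def left_diff_distrib)
  qed (simp add: one_minus_powr_fps_def left_diff_distrib)
qed

lemma one_minus_powr_fps_shift:
  "one_minus_powr_fps b = (1 - fps_X) ^ j * one_minus_powr_fps (b - of_nat j)"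
proof (induction j)
  case (Suc j)
  then show ?case
    using one_minus_powr_fps_step[of "b - of_nat j"] by (simp add: algebra_simps)
qed simp

lemma fps_deriv_one_minus_powr_fps:
  "fps_deriv (one_minus_powr_fps b) = - fps_const b * one_minus_powr_fps (b - 1)"
proof (rule fps_ext)
  fix n
  have "of_nat (n + 1) * (u / fact (Suc n)) = u / fact n" for u :: complex
    by (simp add: divide_simps del: of_nat_Suc)
  then show "fps_nth (fps_deriv (one_minus_powr_fps b)) n =
      fps_nth (- fps_const b * one_minus_powr_fps (b - 1)) n"
    by (simp add: one_minus_powr_fps_def pochhammer_rec[of "- b"] del: of_nat_Suc fact_Suc)
qed

lemma one_minus_powr_fps_nonzero: "one_minus_powr_fps b \<noteq> 0"
proof
  assume "one_minus_powr_fps b = 0"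
  then have "fps_nth (one_minus_powr_fps b) 0 = 0" by simp
  then show False by (simp add: one_minus_powr_fps_def)
qed

text \<open>
  The logarithmic derivative of \<open>W\<close> says that \<open>W\<close> is a constant times \<open>x ^ c * (1 - x) ^ b\<close>
  locally.  With \<open>\<theta> = x d/dx\<close> one has \<open>(-1)\<^sup>i d\<^sup>i \<circ> x\<^sup>i = (-\<theta>-1)(-\<theta>-2)\<cdots>(-\<theta>-i)\<close>, the
  \<open>i\<close>-th falling factorial of \<open>-\<theta>-1\<close>.  Applied to \<open>W Q\<close> it yields a polynomial \<open>R\<close> over a power
  of \<open>1 - x\<close>, because one differentiation lowers \<open>b\<close> by one.  The same \<open>R\<close> describes the formal
  action on \<open>x ^ c Q (1 - x) ^ b\<close>, where \<open>\<theta>\<close> multiplies the term of degree \<open>n + c\<close> by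
  \<open>n + c\<close>.  Having one \<open>R\<close> for both sides lets coefficients at \<open>0\<close> decide an identity of
  functions on an open set \<open>U\<close> that may be disconnected and far from \<open>0\<close>.
\<close>

lemma deriv_iterate_weighted_polynomial:
  fixes W :: "complex \<Rightarrow> complex" and U :: "complex set"
  assumes U: "open U" "0 \<notin> U" "1 \<notin> U"
    and W: "\<And>z. z \<in> U \<Longrightarrow> (W has_field_derivative W z * (c / z - b / (1 - z))) (at z)"
  shows "\<exists>R. (\<forall>z\<in>U. (-1) ^ i * (deriv ^^ i) (\<lambda>z. z ^ i * (W z * poly Q z)) z =
                  W z / (1 - z) ^ i * poly R z) \<and>
    (\<forall>n. fps_nth (fps_of_poly R * one_minus_powr_fps (b - of_nat i)) n =
       falling i (- (of_nat n + c) - 1) * fps_nth (fps_of_poly Q * one_minus_powr_fps b) n)"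
  using W
proof (induction i arbitrary: W b Q)
  case 0
  show ?case by (rule exI[of _ Q]) (simp add: falling_def)
next
  case (Suc i)
  let ?x = "[:0, 1:] :: complex poly" and ?y = "[:1, -1:] :: complex poly"
  \<comment> \<open>The polynomial \<open>Q'\<close> is defined by \<open>(x ^ (i + 1) W Q)' = x ^ i W Q' / (1 - x)\<close>.\<close>
  define Q' where "Q' = smult (of_nat i + 1 + c) (?y * Q) - smult b (?x * Q) + ?x * ?y * pderiv Q"
  define V where "V z = W z / (1 - z)" for z
  have ne: "z \<noteq> 0" "1 - z \<noteq> 0" if "z \<in> U" for z using U that by auto
  have V: "(V has_field_derivative V z * (c / z - (b - 1) / (1 - z))) (at z)" if "z \<in> U" for z
  proof -
    have "((\<lambda>z. W z / (1 - z)) has_field_derivative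
        (W z * (c / z - b / (1 - z)) * (1 - z) - W z * (- 1)) / ((1 - z) * (1 - z))) (at z)"
      using ne[OF that] by (intro DERIV_divide Suc.prems that) (auto intro!: derivative_eq_intros)
    moreover have "(W z * (c / z - b / (1 - z)) * (1 - z) - W z * (- 1)) / ((1 - z) * (1 - z)) =
        V z * (c / z - (b - 1) / (1 - z))"
      using ne[OF that] by (simp add: V_def divide_simps) (simp add: algebra_simps)
    ultimately show ?thesis by (simp add: V_def[abs_def])
  qed
  have d: "((\<lambda>z. z ^ Suc i * (W z * poly Q z)) has_field_derivative z ^ i * (V z * poly Q' z)) (at z)"
    if "z \<in> U" for z
  proof -
    have pow: "((\<lambda>z. z ^ Suc i) has_field_derivative of_nat (Suc i) * z ^ i) (at z)"
      using DERIV_power[OF DERIV_ident, where n = "Suc i" and x = z and s = UNIV]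
      by (simp del: power_Suc of_nat_Suc)
    have "((\<lambda>z. z ^ Suc i * (W z * poly Q z)) has_field_derivative
        of_nat (Suc i) * z ^ i * (W z * poly Q z) +
        (W z * (c / z - b / (1 - z)) * poly Q z + poly (pderiv Q) z * W z) * z ^ Suc i) (at z)"
      by (rule DERIV_mult[OF pow DERIV_mult[OF Suc.prems[OF that] poly_DERIV]])
    moreover have "of_nat (Suc i) * z ^ i * (W z * poly Q z) +
        (W z * (c / z - b / (1 - z)) * poly Q z + poly (pderiv Q) z * W z) * z ^ Suc i =
        z ^ i * (V z * poly Q' z)"
      using ne[OF that] by (simp add: V_def Q'_def divide_simps) (simp add: algebra_simps)
    ultimately show ?thesis by simp
  qed
  obtain R where R: "\<And>z. z \<in> U \<Longrightarrow> (-1) ^ i * (deriv ^^ i) (\<lambda>z. z ^ i * (V z * poly Q' z)) z =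
      V z / (1 - z) ^ i * poly R z"
    "\<And>n. fps_nth (fps_of_poly R * one_minus_powr_fps (b - 1 - of_nat i)) n =
       falling i (- (of_nat n + c) - 1) * fps_nth (fps_of_poly Q' * one_minus_powr_fps (b - 1)) n"
    using Suc.IH[of V "b - 1" Q', OF V] by blast
  have step: "(deriv ^^ Suc i) (\<lambda>z. z ^ Suc i * (W z * poly Q z)) z =
      (deriv ^^ i) (\<lambda>z. z ^ i * (V z * poly Q' z)) z" if "z \<in> U" for z
    unfolding funpow_Suc_right o_def
    by (rule higher_deriv_cong_ev[OF _ refl])
      (rule eventually_mono[OF eventually_nhds_in_open[OF U(1) that]], use d in \<open>auto intro: DERIV_imp_deriv\<close>)
  have fps: "fps_of_poly Q' * one_minus_powr_fps (b - 1) =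
      fps_const (of_nat i + 1 + c) * (fps_of_poly Q * one_minus_powr_fps b) +
      fps_X * fps_deriv (fps_of_poly Q * one_minus_powr_fps b)"
  proof -
    let ?q = "fps_of_poly Q" and ?G = "one_minus_powr_fps (b - 1)"
    have xy: "fps_of_poly ?x = fps_X" "fps_of_poly ?y = 1 - fps_X"
      by (simp_all add: fps_of_poly_pCons flip: fps_const_neg)
    have Q': "fps_of_poly Q' = fps_const (of_nat i + 1 + c) * ((1 - fps_X) * ?q) -
        fps_const b * (fps_X * ?q) + fps_X * (1 - fps_X) * fps_deriv ?q"
      by (simp only: Q'_def fps_of_poly_add fps_of_poly_diff fps_of_poly_smult fps_of_poly_mult
          fps_of_poly_pderiv xy)
    have D: "fps_deriv (?q * one_minus_powr_fps b) =
        ?q * (- fps_const b * ?G) + fps_deriv ?q * ((1 - fps_X) * ?G)"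
      by (simp only: fps_deriv_mult fps_deriv_one_minus_powr_fps one_minus_powr_fps_step[of b, symmetric])
    have ring: "(C * ((1 - X) * q) - B * (X * q) + X * (1 - X) * q') * G =
        C * (q * ((1 - X) * G)) + X * (q * (- B * G) + q' * ((1 - X) * G))"
      for C B X q q' G :: "complex fps"
      by (simp add: algebra_simps)
    show ?thesis
      unfolding D Q' by (simp only: ring one_minus_powr_fps_step[of b])
  qed
  have co: "fps_nth (fps_of_poly Q' * one_minus_powr_fps (b - 1)) n =
      (of_nat n + of_nat i + 1 + c) * fps_nth (fps_of_poly Q * one_minus_powr_fps b) n" for n
  proof -
    have "fps_nth (fps_const a * H + fps_X * fps_deriv H) n = (of_nat n + a) * fps_nth H n"
      for a and H :: "complex fps"
      by (cases n) (simp_all add: distrib_right)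
    then show ?thesis unfolding fps by (simp only: add.assoc)
  qed
  show ?case
  proof (rule exI[of _ "- R"], intro conjI ballI allI)
    fix z assume z: "z \<in> U"
    show "(-1) ^ Suc i * (deriv ^^ Suc i) (\<lambda>z. z ^ Suc i * (W z * poly Q z)) z =
        W z / (1 - z) ^ Suc i * poly (- R) z"
      using R(1)[OF z] unfolding step[OF z] by (simp add: V_def)
  next
    fix n
    have fall: "falling (Suc i) (- (of_nat n + c) - 1) =
        - ((of_nat n + of_nat i + 1 + c) * falling i (- (of_nat n + c) - 1))"
      by (simp add: falling_Suc algebra_simps)
    have "fps_nth (fps_of_poly (- R) * one_minus_powr_fps (b - of_nat (Suc i))) n =
        - fps_nth (fps_of_poly R * one_minus_powr_fps (b - 1 - of_nat i)) n"
      by (simp add: fps_of_poly_uminus diff_diff_eq)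
    then show "fps_nth (fps_of_poly (- R) * one_minus_powr_fps (b - of_nat (Suc i))) n =
        falling (Suc i) (- (of_nat n + c) - 1) * fps_nth (fps_of_poly Q * one_minus_powr_fps b) n"
      unfolding R(2) co fall by (simp only: mult_minus_left mult_minus_right mult_ac)
  qed
qed

text \<open>
  Over the common denominator \<open>(1 - x) ^ N\<close> the sum is \<open>W\<close> times a polynomial \<open>S\<close>, and the
  hypothesis on coefficients says that the product of \<open>S\<close> with an invertible power series vanishes.
\<close>

lemma weighted_polynomial_operator_eq_0:
  fixes W :: "complex \<Rightarrow> complex" and U :: "complex set" and Q :: "nat \<Rightarrow> complex poly"
  assumes U: "open U" "0 \<notin> U" "1 \<notin> U"
    and W: "\<And>z. z \<in> U \<Longrightarrow> (W has_field_derivative W z * (c / z - b / (1 - z))) (at z)"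
    and coeffs: "\<And>n. (\<Sum>i\<le>N. falling i (- (of_nat n + c) - 1) *
                    fps_nth (fps_of_poly (Q i) * one_minus_powr_fps b) n) = 0"
    and z: "z \<in> U"
  shows "(\<Sum>i\<le>N. (-1) ^ i * (deriv ^^ i) (\<lambda>z. z ^ i * (W z * poly (Q i) z)) z) = 0"
proof -
  have "\<forall>i. \<exists>R. (\<forall>z\<in>U. (-1) ^ i * (deriv ^^ i) (\<lambda>z. z ^ i * (W z * poly (Q i) z)) z =
                  W z / (1 - z) ^ i * poly R z) \<and>
    (\<forall>n. fps_nth (fps_of_poly R * one_minus_powr_fps (b - of_nat i)) n =
       falling i (- (of_nat n + c) - 1) * fps_nth (fps_of_poly (Q i) * one_minus_powr_fps b) n)"
    using deriv_iterate_weighted_polynomial[OF U W] by blast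
  then obtain R where "\<And>i. (\<forall>z\<in>U. (-1) ^ i * (deriv ^^ i) (\<lambda>z. z ^ i * (W z * poly (Q i) z)) z =
                  W z / (1 - z) ^ i * poly (R i) z) \<and>
    (\<forall>n. fps_nth (fps_of_poly (R i) * one_minus_powr_fps (b - of_nat i)) n =
       falling i (- (of_nat n + c) - 1) * fps_nth (fps_of_poly (Q i) * one_minus_powr_fps b) n)"
    by (auto dest!: choice)
  then have R: "\<And>i z. z \<in> U \<Longrightarrow> (-1) ^ i * (deriv ^^ i) (\<lambda>z. z ^ i * (W z * poly (Q i) z)) z =
                  W z / (1 - z) ^ i * poly (R i) z"
    "\<And>i n. fps_nth (fps_of_poly (R i) * one_minus_powr_fps (b - of_nat i)) n =
       falling i (- (of_nat n + c) - 1) * fps_nth (fps_of_poly (Q i) * one_minus_powr_fps b) n"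
    by blast+
  define S where "S = (\<Sum>i\<le>N. [:1, -1:] ^ (N - i) * R i)"
  have "fps_of_poly S * one_minus_powr_fps (b - of_nat N) =
      (\<Sum>i\<le>N. fps_of_poly (R i) * one_minus_powr_fps (b - of_nat i))"
  proof -
    have "fps_of_poly ([:1, -1:] ^ (N - i) * R i) * one_minus_powr_fps (b - of_nat N) =
        fps_of_poly (R i) * one_minus_powr_fps (b - of_nat i)" if "i \<le> N" for i
      using one_minus_powr_fps_shift[of "b - of_nat i" "N - i"] that
      by (simp add: fps_of_poly_mult fps_of_poly_power fps_of_poly_pCons of_nat_diff mult_ac)
    then show ?thesis by (simp add: S_def fps_of_poly_sum sum_distrib_right)
  qed
  also have "\<dots> = 0" by (rule fps_ext) (simp only: fps_sum_nth R(2) coeffs fps_zero_nth)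
  finally have "fps_of_poly S = 0" using one_minus_powr_fps_nonzero by auto
  then have S: "S = 0" by simp
  have "1 - z \<noteq> 0" using U z by auto
  then have "(\<Sum>i\<le>N. (-1) ^ i * (deriv ^^ i) (\<lambda>z. z ^ i * (W z * poly (Q i) z)) z) =
      (\<Sum>i\<le>N. W z / (1 - z) ^ N * poly ([:1, -1:] ^ (N - i) * R i) z)"
  proof (intro sum.cong refl)
    fix i assume "i \<in> {..N}"
    then have "(1 - z) ^ N = (1 - z) ^ (N - i) * (1 - z) ^ i" by (simp flip: power_add)
    then show "(-1) ^ i * (deriv ^^ i) (\<lambda>z. z ^ i * (W z * poly (Q i) z)) z =
        W z / (1 - z) ^ N * poly ([:1, -1:] ^ (N - i) * R i) z"
      using \<open>1 - z \<noteq> 0\<close> by (simp add: R(1)[OF z] poly_power)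
  qed
  also have "\<dots> = W z / (1 - z) ^ N * poly S z" by (simp add: S_def poly_sum sum_distrib_left)
  finally show ?thesis by (simp add: S)
qed

section \<open>The Mellin transform of the weighted polynomial\<close>

text \<open>
  The Mellin transform of \<open>p(x) (1 - x) ^ (- k - 1)\<close> on \<open>(0, 1)\<close> is
  \<open>\<Gamma>(\<sigma>) \<Gamma>(-k) / \<Gamma>(\<sigma> - k + l)\<close> times this polynomial in \<open>\<sigma>\<close>, for \<open>p\<close> of degree at most \<open>l\<close>.
\<close>

definition mellin_numerator :: "nat \<Rightarrow> complex \<Rightarrow> complex poly \<Rightarrow> complex \<Rightarrow> complex" where
  "mellin_numerator l k p \<sigma> =
     (\<Sum>n\<le>l. coeff p n * pochhammer \<sigma> n * pochhammer (\<sigma> + of_nat n - k) (l - n))"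

text \<open>
  Pairing with the function of index \<open>(j, t)\<close> is, up to a phase, evaluating the Mellin transform
  at \<open>\<sigma> = jp_exponent m j + t\<close>.
\<close>

definition jp_exponent :: "(nat \<Rightarrow> 'a::comm_ring_1) \<Rightarrow> nat \<Rightarrow> 'a" where
  "jp_exponent m j = 1 - of_nat j - (\<Sum>s=1..j. m s)"

lemma poly_eq_sum_le:
  fixes p :: "'a::comm_semiring_1 poly"
  assumes "degree p \<le> l"
  shows "poly p x = (\<Sum>n\<le>l. coeff p n * x ^ n)"
  unfolding poly_altdef using assms
  by (intro sum.mono_neutral_left) (auto simp: coeff_eq_0)

lemma jp_integrand_has_integral:
  fixes m :: "nat \<Rightarrow> real" and k :: real and f :: "complex poly"
  assumes j: "j \<ge> 1" and \<sigma>: "\<sigma> = jp_exponent m j + real t" "\<sigma> > 0" and k: "k < 0"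
    and deg: "degree f \<le> l"
  shows "(jp_integrand m k (\<lambda>x. poly f (of_real x)) (jp_fun m j t) has_integral
     exp (\<i> * of_real (pi * (- k - 1))) * (\<Sum>n\<le>l. coeff f n * of_real (Beta (\<sigma> + real n) (- k))))
     {0<..<1}"
proof -
  let ?c = "exp (\<i> * of_real (pi * (- k - 1)))"
  have beta: "((\<lambda>x. complex_of_real (x powr (\<sigma> + real n - 1) * (1 - x) powr (- k - 1))) has_integral
      of_real (Beta (\<sigma> + real n) (- k))) {0<..<1}" for n
    using has_integral_Beta_real[of "\<sigma> + real n" "- k"] \<sigma> k
    by (intro has_integral_of_real) (simp add: has_integral_Icc_iff_Ioo)
  have "((\<lambda>x. ?c * (\<Sum>n\<le>l. coeff f n * complex_of_real (x powr (\<sigma> + real n - 1) * (1 - x) powr (- k - 1))))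
      has_integral ?c * (\<Sum>n\<le>l. coeff f n * of_real (Beta (\<sigma> + real n) (- k)))) {0<..<1}"
    by (intro has_integral_mult_right has_integral_sum beta finite_atMost)
  then show ?thesis
  proof (rule has_integral_eq[rotated])
    fix x :: real assume x: "x \<in> {0<..<1}"
    \<comment> \<open>On \<open>(0, 1)\<close> the branch of \<open>(x - 1) ^ (- k - 1)\<close> is a constant phase times the positive power.\<close>
    have Ln: "Ln (complex_of_real x - 1) = of_real (ln (1 - x)) + \<i> * of_real pi"
      using x Ln_of_real'[of "x - 1"] by simp
    have "of_real (x - 1) powr of_real (- k - 1) = exp (of_real (- k - 1) * Ln (complex_of_real x - 1))"
      using x by (simp add: powr_def complex_eq_iff)
    also have "\<dots> = ?c * of_real ((1 - x) powr (- k - 1))"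
      using x by (simp add: Ln powr_def exp_of_real distrib_left mult_ac add.commute flip: exp_add exp_of_real)
    finally have branch: "of_real (x - 1) powr of_real (- k - 1) = ?c * of_real ((1 - x) powr (- k - 1))" .
    have "(\<Sum>i=1..j. m i) = m 1 + (\<Sum>i=2..j. m i)"
      using j by (simp add: sum.atLeast_Suc_atMost numeral_2_eq_2)
    then have "- (\<Sum>i=2..j. m i) - (real j - 1) + real t + (- m 1 - 1) = \<sigma> - 1"
      unfolding \<sigma>(1) jp_exponent_def by simp
    then have "jp_fun m j t x * x powr (- m 1 - 1) = x powr (\<sigma> - 1)"
      unfolding jp_fun_def by (metis powr_add)
    then have weight: "complex_of_real (jp_fun m j t x) * of_real (x powr (- m 1 - 1)) = of_real (x powr (\<sigma> - 1))"
      by (metis of_real_mult)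
    have pow: "x powr (\<sigma> + real n - 1) = x powr (\<sigma> - 1) * x ^ n" for n
      using x by (simp add: powr_add[symmetric] powr_realpow[symmetric] algebra_simps)
    have "jp_integrand m k (\<lambda>x. poly f (of_real x)) (jp_fun m j t) x =
        (of_real (jp_fun m j t x) * of_real (x powr (- m 1 - 1))) *
        (of_real (x - 1) powr of_real (- k - 1)) * poly f (of_real x)"
      unfolding jp_integrand_def by (simp add: mult_ac)
    also have "\<dots> = ?c * (\<Sum>n\<le>l. coeff f n * complex_of_real (x powr (\<sigma> + real n - 1) * (1 - x) powr (- k - 1)))"
      unfolding weight branch poly_eq_sum_le[OF deg] pow
      by (simp add: sum_distrib_left mult_ac)
    finally show "?c * (\<Sum>n\<le>l. coeff f n * complex_of_real (x powr (\<sigma> + real n - 1) * (1 - x) powr (- k - 1))) =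
        jp_integrand m k (\<lambda>x. poly f (of_real x)) (jp_fun m j t) x" by simp
  qed
qed

lemma Beta_in_terms_of_pochhammer:
  fixes \<sigma> k :: real
  assumes "\<sigma> > 0" "k < 0" "n \<le> l"
  shows "Beta (\<sigma> + real n) (- k) = Gamma \<sigma> * Gamma (- k) / Gamma (\<sigma> - k + real l) *
     (pochhammer \<sigma> n * pochhammer (\<sigma> + real n - k) (l - n))"
proof -
  have np: "x \<notin> \<int>\<^sub>\<le>\<^sub>0" if "x > 0" for x :: real using that by (auto elim!: nonpos_Ints_cases)
  have "pochhammer \<sigma> n = Gamma (\<sigma> + real n) / Gamma \<sigma>"
    by (rule pochhammer_Gamma[OF np]) (use assms in simp)
  moreover have "pochhammer (\<sigma> + real n - k) (l - n) =
      Gamma (\<sigma> + real n - k + real (l - n)) / Gamma (\<sigma> + real n - k)"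
    by (rule pochhammer_Gamma[OF np]) (use assms in simp)
  moreover have "\<sigma> + real n - k + real (l - n) = \<sigma> - k + real l" using assms by (simp add: of_nat_diff)
  moreover have "Gamma \<sigma> > 0" "Gamma (\<sigma> - k + real l) > 0" "Gamma (\<sigma> + real n - k) > 0"
    using assms by (auto intro!: Gamma_real_pos)
  ultimately show ?thesis by (simp add: Beta_def algebra_simps)
qed

lemma jp_pairing_zero_imp:
  fixes m :: "nat \<Rightarrow> real" and k :: real and f :: "complex poly"
  assumes "j \<ge> 1" "\<sigma> = jp_exponent m j + real t" "\<sigma> > 0" "k < 0" "degree f \<le> l"
    and zero: "jp_pairing m k (\<lambda>x. poly f (of_real x)) (jp_fun m j t) = 0"
  shows "mellin_numerator l (of_real k) f (of_real \<sigma>) = 0"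
proof -
  define G where "G = Gamma \<sigma> * Gamma (- k) / Gamma (\<sigma> - k + real l)"
  have "G > 0" using assms by (auto simp: G_def intro!: divide_pos_pos mult_pos_pos Gamma_real_pos)
  have "0 = exp (\<i> * of_real (pi * (- k - 1))) * (\<Sum>n\<le>l. coeff f n * of_real (Beta (\<sigma> + real n) (- k)))"
    using integral_unique[OF jp_integrand_has_integral[OF assms(1-5)]] zero
    by (simp add: jp_pairing_def)
  then have "0 = (\<Sum>n\<le>l. coeff f n * of_real (Beta (\<sigma> + real n) (- k)))" by simp
  also have "\<dots> = (\<Sum>n\<le>l. of_real G * (coeff f n * pochhammer (of_real \<sigma>) n *
      pochhammer (of_real \<sigma> + of_nat n - of_real k) (l - n)))"
  proof (intro sum.cong refl)
    fix n assume "n \<in> {..l}"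
    then have "Beta (\<sigma> + real n) (- k) = G * (pochhammer \<sigma> n * pochhammer (\<sigma> + real n - k) (l - n))"
      using Beta_in_terms_of_pochhammer[of \<sigma> k n l] assms by (simp add: G_def)
    then have "complex_of_real (Beta (\<sigma> + real n) (- k)) = of_real G * (pochhammer (of_real \<sigma>) n *
        pochhammer (of_real \<sigma> + of_nat n - of_real k) (l - n))"
      using pochhammer_of_real[of \<sigma> n, where ?'a = complex]
        pochhammer_of_real[of "\<sigma> + real n - k" "l - n", where ?'a = complex] by simp
    then show "coeff f n * of_real (Beta (\<sigma> + real n) (- k)) = of_real G * (coeff f n * pochhammer (of_real \<sigma>) n *
      pochhammer (of_real \<sigma> + of_nat n - of_real k) (l - n))" by simp
  qed
  also have "\<dots> = of_real G * mellin_numerator l (of_real k) f (of_real \<sigma>)"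
    by (simp add: mellin_numerator_def sum_distrib_left)
  finally show ?thesis using \<open>G > 0\<close> by simp
qed

lemma degree_prod_linear_le:
  "degree (\<Prod>i<n. [:c i, 1:] :: complex poly) \<le> n"
  using degree_prod_sum_le[of "{..<n}" "\<lambda>i. [:c i, 1:]"] by simp

text \<open>
  A polynomial of degree at most \<open>l\<close> is determined by its values at \<open>l + 1\<close> points: the \<open>l\<close> zeros
  and one further point, which fixes the constant \<open>C\<close>.
\<close>

lemma mellin_numerator_factorization:
  assumes R: "finite R" "card R = l" and zero: "\<And>\<rho>. \<rho> \<in> R \<Longrightarrow> mellin_numerator l k f \<rho> = 0"
  obtains C where "\<And>\<sigma>. mellin_numerator l k f \<sigma> = C * (\<Prod>\<rho>\<in>R. \<sigma> - \<rho>)"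
proof -
  define N where "N = (\<Sum>n\<le>l. smult (coeff f n) ((\<Prod>i<n. [:of_nat i, 1:]) *
      (\<Prod>i<l-n. [:of_nat n - k + of_nat i, 1:])))"
  have N: "poly N \<sigma> = mellin_numerator l k f \<sigma>" for \<sigma>
    by (simp add: N_def mellin_numerator_def poly_sum poly_prod pochhammer_prod atLeast0LessThan algebra_simps)
  have degN: "degree N \<le> l"
    unfolding N_def
  proof (rule degree_sum_le)
    fix n assume n: "n \<in> {..l}"
    have "degree ((\<Prod>i<n. [:of_nat i, 1:]) * (\<Prod>i<l-n. [:of_nat n - k + of_nat i, 1:])) \<le> n + (l - n)"
      by (rule order.trans[OF degree_mult_le]) (intro add_mono degree_prod_linear_le)
    then show "degree (smult (coeff f n) ((\<Prod>i<n. [:of_nat i, 1:]) *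
      (\<Prod>i<l-n. [:of_nat n - k + of_nat i, 1:]))) \<le> l"
      using n by (intro order.trans[OF degree_smult_le]) simp
  qed simp
  define Z where "Z = (\<Prod>\<rho>\<in>R. [:- \<rho>, 1:])"
  have Z: "poly Z \<sigma> = (\<Prod>\<rho>\<in>R. \<sigma> - \<rho>)" for \<sigma>
    by (simp add: Z_def poly_prod)
  have degZ: "degree Z \<le> l"
    using degree_prod_sum_le[OF R(1), of "\<lambda>\<rho>. [:- \<rho>, 1:]"] R(2) by (simp add: Z_def)
  obtain \<sigma>0 where \<sigma>0: "\<sigma>0 \<notin> R" using R(1) ex_new_if_finite[OF infinite_UNIV_char_0] by blast
  then have nz: "poly Z \<sigma>0 \<noteq> 0" using R(1) by (auto simp: Z)
  define C where "C = poly N \<sigma>0 / poly Z \<sigma>0"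
  have "N = smult C Z"
  proof (rule poly_eqI_degree[of "insert \<sigma>0 R"])
    fix x assume "x \<in> insert \<sigma>0 R"
    moreover have "poly Z x = 0" if "x \<in> R" using that R(1) by (auto simp: Z)
    ultimately show "poly N x = poly (smult C Z) x" using nz zero by (auto simp: C_def N)
  next
    show "card (insert \<sigma>0 R) > degree N" using degN R \<sigma>0 by simp
    show "card (insert \<sigma>0 R) > degree (smult C Z)"
      using degZ R \<sigma>0 degree_smult_le[of C Z] by simp
  qed
  then have "mellin_numerator l k f \<sigma> = C * (\<Prod>\<rho>\<in>R. \<sigma> - \<rho>)" for \<sigma>
    by (simp flip: N Z)
  then show thesis by (rule that)
qed

section \<open>The recurrence for the coefficients\<close>

text \<open>
  Both sides are the product of \<open>u - t\<close> over \<open>t = 0, \<dots>, L\<close>.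
\<close>

lemma prod_shifted_steps:
  fixes u :: "'a::comm_ring_1"
  shows "(u - of_nat L) * (\<Prod>t<L. u - of_nat t) = u * (\<Prod>t<L. u - 1 - of_nat t)"
proof -
  have "(u - of_nat L) * (\<Prod>t<L. u - of_nat t) = (\<Prod>t<Suc L. u - of_nat t)" by (simp add: mult.commute)
  also have "\<dots> = u * (\<Prod>t<L. u - 1 - of_nat t)"
    by (subst prod.lessThan_Suc_shift) (simp add: algebra_simps)
  finally show ?thesis .
qed

text \<open>
  The coefficient of \<open>x ^ n\<close> in \<open>p(x) (1 - x) ^ (- k - 1)\<close> is the residue of the Mellin transform at
  \<open>\<sigma> = -n\<close>, and the other factors come from the Gamma functions there.  They are written with
  Pochhammer symbols on both sides, so that the identity is polynomial in \<open>k\<close> and also covers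
  \<open>n < l\<close>.
\<close>

lemma series_coeff_via_mellin_numerator:
  fixes k :: complex
  assumes "degree p \<le> l"
  shows "(-1) ^ l * fact n * pochhammer (k + 1 - of_nat l) l *
       fps_nth (fps_of_poly p * one_minus_powr_fps (- k - 1)) n =
     pochhammer (k + 1 - of_nat l) n * mellin_numerator l k p (- of_nat n)"
proof -
  let ?c = "k + 1 - of_nat l"
  have h: "fps_nth (fps_of_poly p * one_minus_powr_fps (- k - 1)) n =
      (\<Sum>j\<in>{..l} \<inter> {..n}. coeff p j * (pochhammer (k + 1) (n - j) / fact (n - j)))"
    unfolding fps_mult_nth one_minus_powr_fps_def using assms
    by (intro sum.mono_neutral_cong_right) (auto simp: coeff_eq_0 algebra_simps)
  have N: "mellin_numerator l k p (- of_nat n) = (\<Sum>j\<in>{..l} \<inter> {..n}. coeff p j *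
      pochhammer (- of_nat n) j * pochhammer (- of_nat n + of_nat j - k) (l - j))"
    unfolding mellin_numerator_def
    by (intro sum.mono_neutral_right) (auto simp: pochhammer_of_nat_eq_0_iff)
  show ?thesis
    unfolding h N sum_distrib_left
  proof (intro sum.cong refl)
    fix j assume "j \<in> {..l} \<inter> {..n}"
    then have j: "j \<le> l" "j \<le> n" by auto
    \<comment> \<open>Termwise, all symbols are rewritten with positive steps, and the two factorizations of
      \<open>pochhammer (k + 1 - l) (l + n - j)\<close> are compared.\<close>
    have e1: "pochhammer (- of_nat n :: complex) j = (-1) ^ j * pochhammer (1 + of_nat (n - j)) j"
      using j by (simp add: pochhammer_minus of_nat_diff algebra_simps)
    have e2: "fact n = fact (n - j) * pochhammer (1 + of_nat (n - j) :: complex) j"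
      using pochhammer_product'[of "1::complex" "n - j" j] j by (simp add: pochhammer_fact)
    have e3: "pochhammer (- of_nat n + of_nat j - k) (l - j) =
        (-1) ^ (l - j) * pochhammer (?c + of_nat n) (l - j)"
      using pochhammer_minus[of "of_nat n - of_nat j + k" "l - j"] j
      by (simp add: of_nat_diff algebra_simps)
    have "pochhammer ?c (l + (n - j)) = pochhammer ?c l * pochhammer (k + 1) (n - j)"
      by (simp add: pochhammer_product')
    moreover have "pochhammer ?c (n + (l - j)) = pochhammer ?c n * pochhammer (?c + of_nat n) (l - j)"
      by (simp add: pochhammer_product')
    moreover have "l + (n - j) = n + (l - j)" using j by simp
    ultimately have e4: "pochhammer ?c l * pochhammer (k + 1) (n - j) =
        pochhammer ?c n * pochhammer (?c + of_nat n) (l - j)" by simp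
    have e5: "(-1 :: complex) ^ l = (-1) ^ j * (-1) ^ (l - j)" using j by (simp flip: power_add)
    have "(-1) ^ l * fact n * pochhammer ?c l * (coeff p j * (pochhammer (k + 1) (n - j) / fact (n - j))) =
        (-1) ^ l * coeff p j * (fact n / fact (n - j)) * (pochhammer ?c l * pochhammer (k + 1) (n - j))"
      by simp
    also have "fact n / fact (n - j) = pochhammer (1 + of_nat (n - j) :: complex) j" by (simp add: e2)
    finally show "(-1) ^ l * fact n * pochhammer ?c l * (coeff p j * (pochhammer (k + 1) (n - j) / fact (n - j))) =
        pochhammer ?c n * (coeff p j * pochhammer (- of_nat n) j * pochhammer (- of_nat n + of_nat j - k) (l - j))"
      unfolding e1 e3 e4 e5 by (simp only: mult_ac)
  qed
qed

lemma l_nat_Suc_le: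
  assumes "\<And>i. 1 \<le> i \<Longrightarrow> i < r \<Longrightarrow> l (i + 1) \<le> l i" "1 \<le> j"
  shows "l_nat r l (j + 1) \<le> l_nat r l j"
  using assms by (auto simp: l_nat_def)

lemma sum_gaps:
  assumes "r \<ge> 1" "\<And>i. 1 \<le> i \<Longrightarrow> i < r \<Longrightarrow> l (i + 1) \<le> l i"
  shows "(\<Sum>j=1..r. l_nat r l j - l_nat r l (j + 1)) = l 1"
proof -
  have "(\<Sum>j=1..n. l_nat r l j - l_nat r l (j + 1)) + l_nat r l (n + 1) = l_nat r l 1" for n
  proof (induction n)
    case (Suc n)
    have "l_nat r l (Suc n + 1) \<le> l_nat r l (Suc n)"
      by (rule l_nat_Suc_le) (use assms(2) in auto)
    moreover have "(\<Sum>j=1..Suc n. l_nat r l j - l_nat r l (j + 1)) =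
        (\<Sum>j=1..n. l_nat r l j - l_nat r l (j + 1)) + (l_nat r l (Suc n) - l_nat r l (Suc n + 1))"
      by simp
    ultimately show ?case using Suc.IH by simp
  qed simp
  from this[of r] show ?thesis using assms(1) by (simp add: l_nat_def)
qed

lemma jp_index_eq_Sigma:
  "jp_index r l = (SIGMA j:{1..r}. {..<l_nat r l j - l_nat r l (j + 1)})"
  by (auto simp: jp_index_def)

text \<open>
  The substitution \<open>\<alpha> = a\<^sub>r + \<sigma>\<close> and the reversal \<open>i = r - j\<close> turn the roots of \<open>a\<close> and \<open>d\<close>
  into the exponents of the orthogonality relations; the root of index \<open>r\<close> is the factor that comes
  from the Gamma quotient.
\<close>

lemma prod_jp_a:
  "(\<Prod>i=0..r. jp_a r m r + \<sigma> - jp_a r m i) = \<sigma> * (\<Prod>j=1..r. \<sigma> + 1 - jp_exponent m j)"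
proof -
  have "jp_a r m r + \<sigma> - jp_a r m (r - j) = (if j = 0 then \<sigma> else \<sigma> + 1 - jp_exponent m j)"
    if "j \<le> r" for j
  proof -
    have "(\<Sum>s=1..r. m s) = (\<Sum>s=1..j. m s) + (\<Sum>s=j+1..r. m s)"
      using sum.ub_add_nat[of 1 j m "r - j"] that by simp
    moreover have "r + 1 - (r - j) = j + 1" using that by simp
    ultimately show ?thesis using that
      by (auto simp: jp_a_def jp_exponent_def of_nat_diff)
  qed
  then have "(\<Prod>i=0..r. jp_a r m r + \<sigma> - jp_a r m i) =
      (\<Prod>j=0..r. if j = 0 then \<sigma> else \<sigma> + 1 - jp_exponent m j)"
    by (subst prod.atLeastAtMost_rev) (intro prod.cong, auto)
  then show ?thesis by (simp add: prod.atLeast_Suc_atMost)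
qed

lemma prod_jp_d:
  assumes "r \<ge> 1" "\<And>i. 1 \<le> i \<Longrightarrow> i < r \<Longrightarrow> l (i + 1) \<le> l i"
  shows "(\<Prod>i=0..r. jp_a r m r + \<sigma> - jp_d r l m k i) =
    (\<sigma> - k + of_nat (l 1)) *
    (\<Prod>j=1..r. \<sigma> + 1 - jp_exponent m j - of_nat (l_nat r l j - l_nat r l (j + 1)))"
proof -
  have "jp_a r m r + \<sigma> - jp_d r l m k (r - j) = (if j = 0 then \<sigma> - k + of_nat (l 1)
      else \<sigma> + 1 - jp_exponent m j - of_nat (l_nat r l j - l_nat r l (j + 1)))"
    if "j \<le> r" for j
  proof -
    have "(\<Sum>s=1..r. m s) = (\<Sum>s=1..j. m s) + (\<Sum>s=j+1..r. m s)"
      using sum.ub_add_nat[of 1 j m "r - j"] that by simp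
    moreover have "r + 1 - (r - j) = j + 1" "r - (r - j) = j" using that by simp_all
    ultimately show ?thesis
      using that assms(1) l_nat_Suc_le[of r l j, OF assms(2)]
      by (auto simp: jp_d_def jp_a_def jp_exponent_def of_nat_diff l_ext_def l_nat_def)
  qed
  then have "(\<Prod>i=0..r. jp_a r m r + \<sigma> - jp_d r l m k i) =
      (\<Prod>j=0..r. if j = 0 then \<sigma> - k + of_nat (l 1)
        else \<sigma> + 1 - jp_exponent m j - of_nat (l_nat r l j - l_nat r l (j + 1)))"
    by (subst prod.atLeastAtMost_rev) (intro prod.cong, auto)
  then show ?thesis by (simp add: prod.atLeast_Suc_atMost)
qed

text \<open>
  For each \<open>j\<close> the zeros form a block of consecutive points, so that a shift by one changes only
  the two ends of the block.
\<close>

lemma mellin_numerator_shift: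
  assumes fac: "\<And>\<sigma>. N \<sigma> = C * (\<Prod>(j, t)\<in>jp_index r l. \<sigma> - (jp_exponent m j + of_nat t))"
  shows "(\<Prod>j=1..r. \<sigma> + 1 - jp_exponent m j - of_nat (l_nat r l j - l_nat r l (j + 1))) * N (\<sigma> + 1) =
    (\<Prod>j=1..r. \<sigma> + 1 - jp_exponent m j) * (N \<sigma> :: complex)"
proof -
  let ?L = "\<lambda>j. l_nat r l j - l_nat r l (j + 1)" and ?u = "\<lambda>j. \<sigma> + 1 - jp_exponent m j"
  have N: "N \<sigma> = C * (\<Prod>j=1..r. \<Prod>t<?L j. \<sigma> - (jp_exponent m j + of_nat t))" for \<sigma>
    unfolding fac jp_index_eq_Sigma by (subst prod.Sigma) auto
  have "(\<Prod>j=1..r. ?u j - of_nat (?L j)) * N (\<sigma> + 1) =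
      C * (\<Prod>j=1..r. (?u j - of_nat (?L j)) * (\<Prod>t<?L j. ?u j - of_nat t))"
  proof -
    have "N (\<sigma> + 1) = C * (\<Prod>j=1..r. \<Prod>t<?L j. ?u j - of_nat t)"
      unfolding N by (simp add: diff_diff_eq)
    then show ?thesis by (simp add: prod.distrib)
  qed
  also have "\<dots> = C * (\<Prod>j=1..r. ?u j * (\<Prod>t<?L j. ?u j - 1 - of_nat t))"
    by (simp only: prod_shifted_steps)
  also have "\<dots> = (\<Prod>j=1..r. ?u j) * N \<sigma>"
  proof -
    have "?u j - 1 - of_nat t = \<sigma> - (jp_exponent m j + of_nat t)" for j t by simp
    then have "N \<sigma> = C * (\<Prod>j=1..r. \<Prod>t<?L j. ?u j - 1 - of_nat t)"
      unfolding N by (simp add: diff_diff_eq)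
    then show ?thesis by (simp only: prod.distrib mult.left_commute)
  qed
  finally show ?thesis .
qed

text \<open>
  This is the functional equation \<open>d(\<alpha>) \<phi>(\<alpha> + 1) = a(\<alpha>) \<phi>(\<alpha>)\<close> of the Mellin transform, read
  off at the residues: \<open>mellin_numerator_shift\<close> accounts for the roots of index less than \<open>r\<close> and
  the Gamma quotient for \<open>a\<^sub>r\<close> and \<open>d\<^sub>r\<close>.
\<close>

lemma series_recurrence:
  fixes m :: "nat \<Rightarrow> complex" and k :: complex and p :: "complex poly"
  defines "h \<equiv> \<lambda>n. fps_nth (fps_of_poly p * one_minus_powr_fps (- k - 1)) n"
  assumes r: "r \<ge> 1" and l: "\<And>i. 1 \<le> i \<Longrightarrow> i < r \<Longrightarrow> l (i + 1) \<le> l i"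
    and deg: "degree p \<le> l 1" and k: "pochhammer (k + 1 - of_nat (l 1)) (l 1) \<noteq> 0"
    and fac: "\<And>\<sigma>. mellin_numerator (l 1) k p \<sigma> =
       C * (\<Prod>(j, t)\<in>jp_index r l. \<sigma> - (jp_exponent m j + of_nat t))"
  shows "(\<Prod>i=0..r. jp_a r m r - of_nat (Suc n) - jp_d r l m k i) * h n =
    (\<Prod>i=0..r. jp_a r m r - of_nat (Suc n) - jp_a r m i) * h (Suc n)"
proof -
  let ?N = "mellin_numerator (l 1) k p" and ?c = "k + 1 - of_nat (l 1)"
  define \<sigma> where "\<sigma> = (- of_nat (Suc n) :: complex)"
  define w where "w = (-1) ^ l 1 * pochhammer ?c (l 1)"
  define D' where "D' = (\<Prod>j=1..r. \<sigma> + 1 - jp_exponent m j - of_nat (l_nat r l j - l_nat r l (j + 1)))"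
  define A' where "A' = (\<Prod>j=1..r. \<sigma> + 1 - jp_exponent m j)"
  have w: "w * fact (Suc n) \<noteq> 0" using k by (simp add: w_def del: fact_Suc)
  have h: "w * fact i * h i = pochhammer ?c i * ?N (- of_nat i)" for i
    using series_coeff_via_mellin_numerator[OF deg, where k = k and n = i] by (simp add: w_def h_def mult_ac)
  have shift: "D' * ?N (- of_nat n) = A' * ?N \<sigma>"
    using mellin_numerator_shift[OF fac, of \<sigma>] by (simp add: D'_def A'_def \<sigma>_def)
  have \<sigma>1: "\<sigma> - k + of_nat (l 1) = - (?c + of_nat n)" by (simp add: \<sigma>_def)
  have f: "fact (Suc n) = - \<sigma> * (fact n :: complex)" by (simp add: \<sigma>_def)
  have "w * fact (Suc n) * ((\<sigma> - k + of_nat (l 1)) * D' * h n) =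
      \<sigma> * (?c + of_nat n) * D' * (w * fact n * h n)"
    unfolding \<sigma>1 f by (simp only: mult_minus_left mult_minus_right minus_minus mult_ac)
  also have "\<dots> = \<sigma> * (pochhammer ?c n * (?c + of_nat n)) * (D' * ?N (- of_nat n))"
    unfolding h by simp
  also have "\<dots> = \<sigma> * A' * (pochhammer ?c (Suc n) * ?N (- of_nat (Suc n)))"
    unfolding shift by (simp add: pochhammer_Suc \<sigma>_def del: of_nat_Suc)
  also have "\<dots> = w * fact (Suc n) * (\<sigma> * A' * h (Suc n))"
    unfolding h[symmetric] by (simp del: fact_Suc)
  finally have "(\<sigma> - k + of_nat (l 1)) * D' * h n = \<sigma> * A' * h (Suc n)" using w by simp
  then show ?thesis
    using prod_jp_d[of r l m \<sigma> k, OF r l] prod_jp_a[of r m \<sigma>]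
    by (simp add: D'_def A'_def \<sigma>_def del: of_nat_Suc)
qed

lemma coeff_specialize: "coeff (specialize P m k) i = rf_eval (m(0 := k)) (coeff P i)"
  by (simp add: specialize_def coeff_map_poly rf_zero)

lemma degree_specialize_le: "degree (specialize P m k) \<le> degree P"
  by (intro degree_le) (simp add: coeff_specialize coeff_eq_0 rf_zero)

text \<open>
  For very negative parameters the blocks of zeros for different \<open>j\<close> are far apart.
\<close>

lemma jp_exponent_growth:
  fixes y :: "nat \<Rightarrow> real"
  assumes "\<And>i. y i \<le> - K" "K \<ge> 1" "j < j'"
  shows "jp_exponent y j + (K - 1) \<le> jp_exponent y j'"
  using assms(3)
proof (induction j' rule: less_induct)
  case (less j')
  then obtain i where i: "j' = Suc i" "j \<le> i" by (cases j') auto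
  have "jp_exponent y i + (K - 1) \<le> jp_exponent y j'"
    using assms(1)[of "Suc i"] by (simp add: i jp_exponent_def)
  then show ?case using less.IH[of i] i assms(2) by (cases "i = j") auto
qed

text \<open>
  For parameters near minus infinity all exponents \<open>\<sigma>\<close> are positive, so that the Beta integrals
  converge, and the \<open>l\<^sub>1\<close> zeros given by orthogonality are distinct.  The bound
  \<open>- (l\<^sub>1 + 2)\<close> suffices because each block has at most \<open>l\<^sub>1\<close> points.
\<close>

lemma mellin_numerator_jacobi_pineiro:
  fixes y :: "nat \<Rightarrow> real"
  assumes r: "r \<ge> 1" and l: "\<And>i. 1 \<le> i \<Longrightarrow> i < r \<Longrightarrow> l (i + 1) \<le> l i"
    and P: "is_jacobi_pineiro r l P"
    and y: "\<And>i. y i \<le> - (real (l 1) + 2)"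
    and reg: "defined_at P (\<lambda>i. of_real (y i)) (of_real (y 0))"
  obtains C where "\<And>\<sigma>. mellin_numerator (l 1) (of_real (y 0))
      (specialize P (\<lambda>i. of_real (y i)) (of_real (y 0))) \<sigma> =
    C * (\<Prod>(j, t)\<in>jp_index r l. \<sigma> - (jp_exponent (\<lambda>i. of_real (y i)) j + of_nat t))"
proof -
  let ?y = "\<lambda>i. complex_of_real (y i)"
  let ?p = "specialize P ?y (of_real (y 0))"
  let ?\<rho> = "\<lambda>(j, t). jp_exponent y j + real t" and ?\<rho>c = "\<lambda>(j, t). jp_exponent ?y j + of_nat t"
  have neg: "y i < 0" for i using y[of i] by simp
  have deg: "degree ?p \<le> l 1"
    using degree_specialize_le P by (metis is_jacobi_pineiro_def)
  have exps: "jp_exponent y j > 0" if "j \<ge> 1" for j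
  proof -
    have "jp_exponent y 0 + (real (l 1) + 2 - 1) \<le> jp_exponent y j"
      using that by (intro jp_exponent_growth y) auto
    then show ?thesis by (simp add: jp_exponent_def)
  qed
  have \<rho>c: "?\<rho>c q = of_real (?\<rho> q)" for q by (cases q) (simp add: jp_exponent_def)
  have conv: "jp_converges r l y (y 0)"
    unfolding jp_converges_def
  proof (intro ballI, clarify)
    fix j t and f :: "complex poly"
    assume "(j, t) \<in> jp_index r l" "degree f \<le> l 1"
    moreover from this have "j \<ge> 1" by (simp add: jp_index_def)
    ultimately show "jp_integrand y (y 0) (\<lambda>x. poly f (of_real x)) (jp_fun y j t) integrable_on {0<..<1}"
      using exps[of j] neg
      by (intro has_integral_integrable[OF jp_integrand_has_integral[OF _ refl]]) auto
  qed
  have zero: "mellin_numerator (l 1) (of_real (y 0)) ?p (?\<rho>c q) = 0" if "q \<in> jp_index r l" for q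
  proof -
    obtain j t where q: "q = (j, t)" by (cases q)
    have j: "j \<ge> 1" using that by (simp add: q jp_index_def)
    have "jp_pairing y (y 0) (\<lambda>x. poly ?p (of_real x)) (jp_fun y j t) = 0"
      using P neg reg conv that unfolding is_jacobi_pineiro_def q by blast
    from jp_pairing_zero_imp[OF j refl _ neg deg this] exps[OF j]
    show ?thesis unfolding \<rho>c q by simp
  qed
  have small: "t < l 1" if "(j, t) \<in> jp_index r l" for j t
  proof -
    have "l_nat r l j - l_nat r l (j + 1) \<le> (\<Sum>j=1..r. l_nat r l j - l_nat r l (j + 1))"
      by (rule member_le_sum) (use that in \<open>auto simp: jp_index_def\<close>)
    then show ?thesis using that sum_gaps[of r l, OF r l] by (simp add: jp_index_def)
  qed
  have less: "?\<rho> (j, t) < ?\<rho> (j', t')" if "(j, t) \<in> jp_index r l" "j < j'" for j t j' t'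
    using jp_exponent_growth[of y "real (l 1) + 2" j j'] y small[OF that(1)] that(2) by simp
  have "inj_on ?\<rho> (jp_index r l)"
  proof (rule inj_onI)
    fix q q' assume q: "q \<in> jp_index r l" "q' \<in> jp_index r l" "?\<rho> q = ?\<rho> q'"
    obtain j t j' t' where *: "q = (j, t)" "q' = (j', t')" by (cases q, cases q')
    have "j = j'" using less[of j t j' t'] less[of j' t' j t] q unfolding * by force
    then show "q = q'" using q unfolding * by simp
  qed
  then have inj: "inj_on ?\<rho>c (jp_index r l)" unfolding \<rho>c by (simp add: inj_on_def)
  have "card (?\<rho>c ` jp_index r l) = l 1"
    using card_image[OF inj] sum_gaps[of r l, OF r l] by (simp add: jp_index_eq_Sigma)
  moreover have "finite (?\<rho>c ` jp_index r l)" by (simp add: jp_index_eq_Sigma)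
  ultimately obtain C where C: "\<And>\<sigma>. mellin_numerator (l 1) (of_real (y 0)) ?p \<sigma> =
      C * (\<Prod>\<rho>\<in>?\<rho>c ` jp_index r l. \<sigma> - \<rho>)"
    using mellin_numerator_factorization[of "?\<rho>c ` jp_index r l" "l 1" "of_real (y 0)" ?p] zero by blast
  have "(\<Prod>\<rho>\<in>?\<rho>c ` jp_index r l. \<sigma> - \<rho>) =
      (\<Prod>(j, t)\<in>jp_index r l. \<sigma> - (jp_exponent ?y j + of_nat t))" for \<sigma>
    by (subst prod.reindex[OF inj]) (auto intro!: prod.cong)
  then show thesis by (intro that[of C]) (simp only: C)
qed

text \<open>
  The coefficient of \<open>x ^ n\<close> in \<open>x ^ j (1 - x) ^ (- k - 1)\<close>.
\<close>

definition binomial_weight :: "complex \<Rightarrow> nat \<Rightarrow> nat \<Rightarrow> complex" where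
  "binomial_weight k n j = (if j \<le> n then pochhammer (k + 1) (n - j) / fact (n - j) else 0)"

lemma series_coeff_eq:
  assumes "degree p \<le> l"
  shows "fps_nth (fps_of_poly p * one_minus_powr_fps (- k - 1)) n =
    (\<Sum>j\<le>l. coeff p j * binomial_weight k n j)"
  unfolding fps_mult_nth one_minus_powr_fps_def using assms
  by (intro sum.mono_neutral_cong) (auto simp: coeff_eq_0 binomial_weight_def algebra_simps)

lemma polynomial_function_binomial_weight:
  "polynomial_function (\<lambda>y. binomial_weight (y 0) n j)"
proof (cases "j \<le> n")
  case True
  have "polynomial_function (\<lambda>y. (1 / fact (n - j)) * (\<Prod>i<n-j. y 0 + (1 + of_nat i)))"
    by (intro polynomial_function_mult polynomial_function_prod polynomial_function_add
        polynomial_function_const polynomial_function_var)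
  then show ?thesis
    using True by (simp add: binomial_weight_def pochhammer_prod atLeast0LessThan algebra_simps)
qed (simp add: binomial_weight_def polynomial_function_const)

lemma polynomial_function_jp_a: "polynomial_function (\<lambda>y. jp_a r y i)"
  unfolding jp_a_def
  by (intro polynomial_function_add polynomial_function_sum polynomial_function_const
      polynomial_function_var)

lemma polynomial_function_jp_d: "polynomial_function (\<lambda>y. jp_d r l y (y 0) i)"
proof -
  have "polynomial_function (\<lambda>y. l_ext r l (y 0) i)" for i
    unfolding l_ext_def by (cases "i = 0") auto
  then show ?thesis
    unfolding jp_d_def
    by (intro polynomial_function_add polynomial_function_diff polynomial_function_sum
        polynomial_function_const polynomial_function_var)
qed

text \<open>
  Each instance of the recurrence is linear in the coefficients of the polynomial, with factors that
  are polynomial in the parameters.  Hence it extends from real parameters near minus infinity to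
  all parameters at which the polynomial is defined, including those at which zeros of the Mellin
  transform collide or \<open>k\<close> is a nonnegative integer.
\<close>

lemma jacobi_pineiro_recurrence:
  fixes m :: "nat \<Rightarrow> complex" and k :: complex and P :: "ratfun poly"
  defines "h \<equiv> \<lambda>n. fps_nth (fps_of_poly (specialize P m k) * one_minus_powr_fps (- k - 1)) n"
  assumes r: "r \<ge> 1" and l: "\<And>i. 1 \<le> i \<Longrightarrow> i < r \<Longrightarrow> l (i + 1) \<le> l i"
    and P: "is_jacobi_pineiro r l P" and reg: "defined_at P m k"
  shows "(\<Prod>i=0..r. jp_a r m r - of_nat (Suc n) - jp_d r l m k i) * h n =
    (\<Prod>i=0..r. jp_a r m r - of_nat (Suc n) - jp_a r m i) * h (Suc n)"
proof -
  define D where "D y = (\<Prod>i=0..r. jp_a r y r - of_nat (Suc n) - jp_d r l y (y 0) i)" for y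
  define A where "A y = (\<Prod>i=0..r. jp_a r y r - of_nat (Suc n) - jp_a r y i)" for y :: "nat \<Rightarrow> complex"
  define c where "c j y = D y * binomial_weight (y 0) n j - A y * binomial_weight (y 0) (Suc n) j"
    for j and y :: "nat \<Rightarrow> complex"
  have degP: "degree (specialize P m k) \<le> l 1" for m k
    using degree_specialize_le P by (metis is_jacobi_pineiro_def)
  have linear: "(\<Sum>j\<le>l 1. coeff p j * c j y) =
      D y * fps_nth (fps_of_poly p * one_minus_powr_fps (- y 0 - 1)) n -
      A y * fps_nth (fps_of_poly p * one_minus_powr_fps (- y 0 - 1)) (Suc n)"
    if "degree p \<le> l 1" for p y
    unfolding series_coeff_eq[OF that] c_def
    by (simp add: sum_distrib_left sum_subtractf right_diff_distrib mult_ac)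
  have "(\<Sum>j\<le>l 1. rf_eval (m(0 := k)) (coeff P j) * c j (m(0 := k))) = 0"
  proof (rule linear_relation_extends_to_regular_points[where K = "real (l 1) + 2"])
    show "polynomial_function (c j)" for j
      unfolding c_def D_def A_def
      by (intro polynomial_function_diff polynomial_function_mult polynomial_function_prod
          polynomial_function_const polynomial_function_jp_a polynomial_function_jp_d
          polynomial_function_binomial_weight)
  next
    fix y :: "nat \<Rightarrow> real"
    let ?y = "\<lambda>i. complex_of_real (y i)"
    have upd: "?y(0 := of_real (y 0)) = ?y" by auto
    assume y: "\<And>i. y i \<le> - (real (l 1) + 2)" and "\<And>j. rf_regular (coeff P j) ?y"
    then have reg': "defined_at P ?y (of_real (y 0))"
      unfolding defined_at_def upd by blast
    obtain C where C: "\<And>\<sigma>. mellin_numerator (l 1) (of_real (y 0)) (specialize P ?y (of_real (y 0))) \<sigma> =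
        C * (\<Prod>(j, t)\<in>jp_index r l. \<sigma> - (jp_exponent ?y j + of_nat t))"
      using mellin_numerator_jacobi_pineiro[of r l P y, OF r l P y reg'] by blast
    have "pochhammer (?y 0 + 1 - of_nat (l 1)) (l 1) \<noteq> 0"
    proof
      assume "pochhammer (?y 0 + 1 - of_nat (l 1)) (l 1) = 0"
      then obtain i where i: "i < l 1" "?y 0 + 1 - of_nat (l 1) = - of_nat i"
        by (auto simp: pochhammer_eq_0_iff)
      have "y 0 + 1 - real (l 1) = - real i" using arg_cong[OF i(2), of Re] by simp
      then show False using i(1) y[of 0] by simp
    qed
    from series_recurrence[of r l, OF r l degP this C, of n]
    have "(\<Sum>j\<le>l 1. coeff (specialize P ?y (of_real (y 0))) j * c j ?y) = 0"
      unfolding linear[OF degP] by (simp add: D_def A_def)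
    then show "(\<Sum>j\<le>l 1. rf_eval ?y (coeff P j) * c j ?y) = 0"
      unfolding coeff_specialize upd .
  next
    show "rf_regular (coeff P j) (m(0 := k))" for j using reg by (simp add: defined_at_def)
  qed
  then have "D (m(0 := k)) * h n - A (m(0 := k)) * h (Suc n) = 0"
    using linear[OF degP, of m k "m(0 := k)"] by (simp add: coeff_specialize h_def)
  moreover have "(\<Sum>s=r+1-i..r. (m(0 := k)) s) = (\<Sum>s=r+1-i..r. m s)" if "i \<le> r" for i
    using that by (intro sum.cong) auto
  then have "jp_a r (m(0 := k)) i = jp_a r m i" "jp_d r l (m(0 := k)) k i = jp_d r l m k i"
    if "i \<le> r" for i using that by (simp_all add: jp_a_def jp_d_def)
  then have "D (m(0 := k)) = (\<Prod>i=0..r. jp_a r m r - of_nat (Suc n) - jp_d r l m k i)"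
    "A (m(0 := k)) = (\<Prod>i=0..r. jp_a r m r - of_nat (Suc n) - jp_a r m i)"
    unfolding D_def A_def by (auto intro!: prod.cong)
  ultimately show ?thesis by simp
qed

section \<open>The differential equation\<close>

theorem corollary6p2:
  fixes r :: nat and l :: "nat \<Rightarrow> nat" and m :: "nat \<Rightarrow> complex" and k :: complex
    and P :: "ratfun poly" and U :: "complex set" and \<tau> :: "complex \<Rightarrow> complex" and x :: complex
  assumes "r \<ge> 1"
    and "\<And>i. 1 \<le> i \<Longrightarrow> i < r \<Longrightarrow> l (i + 1) \<le> l i"
    and "is_jacobi_pineiro r l P"
    and "defined_at P m k"
    and "open U" and "tau_branch r m k U \<tau>" and "x \<in> U"
  shows "jp_operator r l m k \<tau> (poly (specialize P m k)) x = 0"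
proof -
  let ?p = "specialize P m k" and ?A = "jp_A r l m k" and ?B = "jp_B r m"
  \<comment> \<open>Writing \<open>W = 1 / (\<tau> (x - 1) x ^ (r + 1))\<close>, the \<open>i\<close>-th summand of the operator
    differentiates \<open>x ^ i W Q\<^sub>i\<close>, and \<open>W\<close> is a product of powers of \<open>x\<close> and \<open>x - 1\<close>.\<close>
  define b where "b = - k - 1"
  define c where "c = - jp_a r m r - 1"
  define h where "h n = fps_nth (fps_of_poly ?p * one_minus_powr_fps b) n" for n
  define Q where "Q i = smult (?A i) (pCons 0 ?p) - smult (?B i) ?p" for i
  obtain L0 L1 where L: "L0 holomorphic_on U" "L1 holomorphic_on U"
    "\<And>z. z \<in> U \<Longrightarrow> exp (L0 z) = z" "\<And>z. z \<in> U \<Longrightarrow> exp (L1 z) = z - 1"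
    "\<And>z. z \<in> U \<Longrightarrow> \<tau> z = exp (k * L1 z) * exp ((\<Sum>i=1..r. m i) * L0 z)"
    using assms(6) unfolding tau_branch_def by blast
  have ne: "z \<noteq> 0" "z - 1 \<noteq> 0" if "z \<in> U" for z using L(3,4)[OF that] by (metis exp_not_eq_zero)+
  have U: "0 \<notin> U" "1 \<notin> U" using ne by force+
  define W where "W z = exp (b * L1 z + c * L0 z)" for z
  have log_deriv: "(L has_field_derivative 1 / (z - a)) (at z)"
    if "L holomorphic_on U" "\<And>z. z \<in> U \<Longrightarrow> exp (L z) = z - a" "z \<in> U" for L a z
  proof -
    have L': "(L has_field_derivative deriv L z) (at z)"
      using that assms(5) by (intro holomorphic_derivI)
    then have "((\<lambda>z. exp (L z)) has_field_derivative exp (L z) * deriv L z) (at z)"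
      by (rule DERIV_chain2[OF DERIV_exp])
    then have "((\<lambda>z. z - a) has_field_derivative exp (L z) * deriv L z) (at z)"
      by (rule DERIV_cong_ev[THEN iffD1, OF refl _ refl, rotated])
        (rule eventually_mono[OF eventually_nhds_in_open[OF assms(5) that(3)]], use that in auto)
    moreover have "((\<lambda>z. z - a) has_field_derivative 1) (at z)"
      by (auto intro!: derivative_eq_intros)
    ultimately have "(z - a) * deriv L z = 1" using DERIV_unique that by metis
    then show ?thesis using L' by (metis divide_eq_eq mult.commute mult_eq_0_iff zero_neq_one)
  qed
  have W: "(W has_field_derivative W z * (c / z - b / (1 - z))) (at z)" if "z \<in> U" for z
  proof -
    have "((\<lambda>z. b * L1 z + c * L0 z) has_field_derivative b * (1 / (z - 1)) + c * (1 / (z - 0))) (at z)"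
      using L that by (intro DERIV_add DERIV_cmult log_deriv) auto
    from DERIV_chain2[OF DERIV_exp this]
    have "(W has_field_derivative W z * (b * (1 / (z - 1)) + c * (1 / (z - 0)))) (at z)"
      by (simp add: W_def[abs_def])
    moreover have "b * (1 / (z - 1)) + c * (1 / (z - 0)) = c / z - b / (1 - z)"
    proof -
      have "b / (1 - z) = - (b / (z - 1))" by (metis minus_diff_eq minus_divide_right)
      then show ?thesis by simp
    qed
    ultimately show ?thesis by simp
  qed
  have W_tau: "W z * (\<tau> z * (z - 1) * z ^ (r + 1)) = 1" if "z \<in> U" for z
  proof -
    have "\<tau> z * (z - 1) * z ^ (r + 1) =
        exp (k * L1 z) * exp ((\<Sum>i=1..r. m i) * L0 z) * exp (L1 z) * exp (of_nat (r + 1) * L0 z)"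
      using L(3,4,5)[OF that] by (simp only: exp_of_nat_mult)
    also have "\<dots> = exp (- (b * L1 z + c * L0 z))"
      unfolding exp_add[symmetric]
      by (rule arg_cong[of _ _ exp]) (simp add: b_def c_def jp_a_def algebra_simps)
    finally show ?thesis by (simp add: W_def flip: exp_add)
  qed
  have integrand: "(?A i * z - ?B i) / (z ^ (r + 1 - i) * (z - 1)) * (poly ?p z / \<tau> z) =
      z ^ i * (W z * poly (Q i) z)" if "z \<in> U" "i \<le> r + 1" for z i
  proof -
    have "\<tau> z \<noteq> 0" using L(5)[OF that(1)] by simp
    have zr: "z ^ (r + 1) = z ^ i * z ^ (r + 1 - i)" using that(2) by (simp flip: power_add)
    have "W z = 1 / (\<tau> z * (z - 1) * z ^ (r + 1))"
      using W_tau[OF that(1)] ne[OF that(1)] \<open>\<tau> z \<noteq> 0\<close> by (simp add: eq_divide_eq)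
    then have Wz: "W z = 1 / (\<tau> z * (z - 1) * (z ^ i * z ^ (r + 1 - i)))" unfolding zr .
    have Qz: "poly (Q i) z = (?A i * z - ?B i) * poly ?p z" by (simp add: Q_def algebra_simps)
    have "u / (v * w) * (q / t) = a * (1 / (t * w * (a * v)) * (u * q))" if "a \<noteq> 0"
      for a u v w q t :: complex
      using that by simp
    from this[of "z ^ i"] show ?thesis unfolding Wz Qz using ne[OF that(1)] by simp
  qed
  have coeffs: "(\<Sum>i\<le>r+1. falling i (- (of_nat n + c) - 1) *
      fps_nth (fps_of_poly (Q i) * one_minus_powr_fps b) n) = 0" for n
  proof -
    \<comment> \<open>The sums over \<open>i\<close> recombine the falling factorials to \<open>d\<close> and \<open>a\<close> at \<open>a\<^sub>r - n\<close>; for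
      \<open>n = 0\<close> the factor \<open>a(a\<^sub>r) = 0\<close> replaces the recurrence.\<close>
    define g where "g = (if n = 0 then 0 else h (n - 1))"
    define \<alpha> where "\<alpha> = jp_a r m r - of_nat n"
    have \<alpha>: "- (of_nat n + c) - 1 = \<alpha>" by (simp add: \<alpha>_def c_def)
    have "fps_of_poly (Q i) * one_minus_powr_fps b =
        fps_const (?A i) * (fps_X * (fps_of_poly ?p * one_minus_powr_fps b)) -
        fps_const (?B i) * (fps_of_poly ?p * one_minus_powr_fps b)" for i
      unfolding Q_def fps_of_poly_diff fps_of_poly_smult fps_of_poly_pCons
      by (simp add: algebra_simps)
    then have nth: "fps_nth (fps_of_poly (Q i) * one_minus_powr_fps b) n = ?A i * g - ?B i * h n" for i
      by (simp add: g_def h_def)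
    then have "(\<Sum>i\<le>r+1. falling i (- (of_nat n + c) - 1) *
        fps_nth (fps_of_poly (Q i) * one_minus_powr_fps b) n) =
        (\<Sum>i=0..Suc r. ?A i * falling i \<alpha>) * g - (\<Sum>i=0..Suc r. ?B i * falling i \<alpha>) * h n"
      unfolding \<alpha> atLeast0AtMost Suc_eq_plus1 sum_distrib_right sum_subtractf[symmetric]
      by (intro sum.cong refl) (simp only: nth right_diff_distrib mult_ac)
    also have "\<dots> = (\<Prod>i=0..r. \<alpha> - jp_d r l m k i) * g - (\<Prod>i=0..r. \<alpha> - jp_a r m i) * h n"
      using falling_coeffs_prod[where a = \<alpha> and d = "jp_d r l m k" and r = r]
        falling_coeffs_prod[where a = \<alpha> and d = "jp_a r m" and r = r]
      by (simp only: jp_A_def jp_B_def Suc_eq_plus1)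
    also have "\<dots> = 0"
    proof (cases n)
      case 0
      then have "(\<Prod>i=0..r. \<alpha> - jp_a r m i) = 0" by (intro prod_zero) (auto simp: \<alpha>_def)
      then show ?thesis by (simp add: g_def 0)
    next
      case (Suc n')
      show ?thesis
        using jacobi_pineiro_recurrence[of r l, OF assms(1-4), of n'] unfolding \<alpha>_def g_def Suc h_def b_def
        by simp
    qed
    finally show ?thesis .
  qed
  have cong: "(deriv ^^ i) (\<lambda>z. (?A i * z - ?B i) / (z ^ (r + 1 - i) * (z - 1)) * (poly ?p z / \<tau> z)) x =
      (deriv ^^ i) (\<lambda>z. z ^ i * (W z * poly (Q i) z)) x" if "i \<le> r + 1" for i
    by (rule higher_deriv_cong_ev[OF _ refl])
      (rule eventually_mono[OF eventually_nhds_in_open[OF assms(5,7)]], use integrand that in blast)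
  have "jp_operator r l m k \<tau> (poly ?p) x = \<tau> x * ((-1) ^ (r + 1) *
      (\<Sum>i\<le>r+1. (-1) ^ i * (deriv ^^ i) (\<lambda>z. z ^ i * (W z * poly (Q i) z)) x))"
    unfolding jp_operator_def atLeast0AtMost sum_distrib_left
  proof (intro sum.cong refl)
    fix i assume "i \<in> {..r+1}"
    then have "i \<le> r + 1" by simp
    from cong[OF this]
    show "\<tau> x * ((-1) ^ (r + 1 + i) * (deriv ^^ i)
        (\<lambda>z. (?A i * z - ?B i) / (z ^ (r + 1 - i) * (z - 1)) * (poly ?p z / \<tau> z)) x) =
      \<tau> x * ((-1) ^ (r + 1) * ((-1) ^ i * (deriv ^^ i) (\<lambda>z. z ^ i * (W z * poly (Q i) z)) x))"
      by (simp only: power_add[of "-1" "r + 1" i] mult.assoc)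
  qed
  also have "(\<Sum>i\<le>r+1. (-1) ^ i * (deriv ^^ i) (\<lambda>z. z ^ i * (W z * poly (Q i) z)) x) = 0"
    by (rule weighted_polynomial_operator_eq_0[OF assms(5) U W coeffs assms(7)])
  finally show ?thesis by simp
qed

end
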